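(* Consider the game with uncertain constraint sets described in the context, with $M$ agents, decision variables $x^j\in\mathbb{R}^m$, $x=(x^1,\dots,x^M)\in\mathbb{R}^n$ with $n=Mm$, and $N$ independent samples $\delta_1,\dots,\delta_N$ from $(\Delta,\mathcal{F},\mathbb{P})$. Assume that for every $j\in\{1,\dots,M\}$ the cost function $J^j$ is continuously differentiable, and convex in $x^j$ for any fixed $x^{-j}$, and that the sets $\mathcal{X}^j=\bigcap_{i=1}^N\mathcal{X}^j_{\delta_i}$, $j=1,\dots,M$, are non-empty, closed and convex for every tuple $(\delta_1,\dots,\delta_N)$ and for every $N$. (1) Then, a Nash equilibrium exists. (2) Further assume that the operator $$F(x)\doteq\begin{bmatrix}\nabla_{x^1}J^1(x)\\ \vdots\\ \nabla_{x^M}J^M(x)\end{bmatrix}$$ is strongly monotone on $\mathcal{X}^1\times\dots\times\mathcal{X}^M$ (for every tuple $(\delta_1,\dots,\delta_N)$ and every $N$). Then the Nash equilibrium $x_{\rm NE}$ is unique. (3) Fix $\beta\in(0,1)$, let $t:\mathbb{N}\to\mathbb{R}$ be the function associated with $N$ and $\beta$ defined in the context, and let $\varepsilon(k)\doteq1-t(k)$. In addition to the previous assumptions, assume that $x_{\rm NE}$ coincides $\mathbb{P}^N$-almost surely with the Nash equilibrium of the game obtained by eliminating all the constraints that are not of support. Then the following a-posteriori and a-priori bounds hold for any $\Delta$ and $\mathbb{P}$: $$\mathbb{P}^N[V(x_{\rm NE})\le\varepsilon(s^\star)]\ge1-\beta\qquad\text{and}\qquad \mathbb{P}^N[V(x_{\rm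 NE})\le\varepsilon(n)]\ge1-\beta,$$ where $n$ is the dimension of the decision variable $x$ and $s^\star$ is the number of support constraints of $x_{\rm NE}$.
   Context: Game: agents $j\in\{1,\dots,M\}$; $(\Delta,\mathcal{F},\mathbb{P})$ is a probability space; for each $j$, $\{\mathcal{X}^j_\delta\}_{\delta\in\Delta}$ is a family of subsets of $\mathbb{R}^m$. Given samples $\delta_1,\dots,\delta_N$, agent $j$ selects $x^j\in\mathcal{X}^j\doteq\bigcap_{i=1}^N\mathcal{X}^j_{\delta_i}$ (an empty intersection being $\mathbb{R}^m$) and aims at minimizing the real-valued cost $J^j(x)=J^j(x^j,x^{-j})$, defined for $x\in\mathbb{R}^n$, where $x=(x^1,\dots,x^M)$ and $x^{-j}=(x^1,\dots,x^{j-1},x^{j+1},\dots,x^M)$. Nash equilibrium: a tuple $x_{\rm NE}=(x_{\rm NE}^1,\dots,x_{\rm NE}^M)\in\mathcal{X}^1\times\dots\times\mathcal{X}^M$ with $J^j(x_{\rm NE}^j,x_{\rm NE}^{-j})\le J^j(x^j,x_{\rm NE}^{-j})$ for all $x^j\in\mathcal{X}^j$ and all agents $j$. Let $\mathcal{X}_\delta\doteq\mathcal{X}^1_\delta\times\dots\times\mathcal{X}^M_\delta$. The $i$-th constraint is $x\in\mathcal{X}_{\delta_i}$ (the uncertainty is shared among the agents). It is of support for the Nash equilibrium problem if its removal changes the solution $x_{\rm NE}$. Risk: $V(x)\doteq\mathbb{P}\{\delta\in\Delta : x\notin\mathcal{X}_\delta\}$. Strong monotonicity of $F$ on a set $\mathcal{X}$: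 there exists $\alpha>0$ with $(F(x)-F(y))^\top(x-y)\ge\alpha\|x-y\|^2$ for all $x,y\in\mathcal{X}$. The function $t$: for $k\in\{0,\dots,N-1\}$, $t(k)$ is the unique solution in $(0,1)$ of the polynomial equation in $t$ $$\frac{\beta}{N+1}\sum_{l=k}^{N}\binom{l}{k}t^{l-k}-\binom{N}{k}t^{N-k}=0$$ (existence and uniqueness of this root is a known fact), and $t(k)=0$ for $k\ge N$. All quantities involved are assumed measurable. $\mathbb{P}^N$ is the $N$-fold product measure.
   Formalization: In part (1) the sets X^j of the game are also assumed bounded: without this the claim fails (one agent, J(x)=x, X_δ=R for all δ has no Nash equilibrium); parts (2) and (3) do not assume boundedness, and (2) gives existence as well as uniqueness. *)

theory Defs
  imports "HOL-Probability.Probability"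
begin

text \<open>
  Agents are the elements of a finite type \<open>'k\<close>, so that \<open>M = CARD('k)\<close>; a strategy profile is
  \<open>x :: real^'m^'k\<close> with blocks \<open>x $ j :: real^'m\<close>. The norm and inner product of
  \<open>real^'m^'k\<close> are the Euclidean ones of the space of dimension \<open>CARD('k) * CARD('m)\<close>.
\<close>

definition deviate :: "real^'m^'k \<Rightarrow> 'k \<Rightarrow> real^'m \<Rightarrow> real^'m^'k::finite" where
  "deviate x j y = (\<chi> i. if i = j then y else x $ i)"

definition profiles :: "('k::finite \<Rightarrow> (real^'m) set) \<Rightarrow> (real^'m^'k) set" where
  "profiles C = {x. \<forall>j. x $ j \<in> C j}"

definition nash_equilibrium ::
  "('k::finite \<Rightarrow> real^'m^'k \<Rightarrow> real) \<Rightarrow> ('k \<Rightarrow> (real^'m) set) \<Rightarrow> real^'m^'k \<Rightarrow> bool" where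
  "nash_equilibrium J C x \<longleftrightarrow>
     x \<in> profiles C \<and> (\<forall>j. \<forall>y \<in> C j. J j x \<le> J j (deviate x j y))"

definition continuously_differentiable :: "('a::real_inner \<Rightarrow> real) \<Rightarrow> bool" where
  "continuously_differentiable f \<longleftrightarrow>
     (\<exists>g. (\<forall>x. GDERIV f x :> g x) \<and> continuous_on UNIV g)"

definition partial_gradient ::
  "'k::finite \<Rightarrow> (real^'m::finite^'k \<Rightarrow> real) \<Rightarrow> real^'m^'k \<Rightarrow> real^'m" where
  "partial_gradient j f x = (THE g. GDERIV (\<lambda>y. f (deviate x j y)) (x $ j) :> g)"

definition game_operator ::
  "('k::finite \<Rightarrow> real^'m::finite^'k \<Rightarrow> real) \<Rightarrow> real^'m^'k \<Rightarrow> real^'m^'k" where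
  "game_operator J x = (\<chi> j. partial_gradient j (J j) x)"

definition strongly_monotone_on :: "'a::real_inner set \<Rightarrow> ('a \<Rightarrow> 'a) \<Rightarrow> bool" where
  "strongly_monotone_on S F \<longleftrightarrow>
     (\<exists>\<alpha>>0. \<forall>x\<in>S. \<forall>y\<in>S. (F x - F y) \<bullet> (x - y) \<ge> \<alpha> * (norm (x - y))\<^sup>2)"

text \<open>
  A sample is a function \<open>\<omega> :: nat \<Rightarrow> 'd\<close>, of which the game with \<open>N\<close> samples uses the values
  \<open>\<omega> 0, \<dots>, \<omega> (N - 1)\<close>. Games with some constraints removed are obtained by letting the index
  set \<open>I\<close> be a subset of \<open>{..<N}\<close>; the intersection is the whole space when \<open>I\<close> is empty.
\<close>

definition strategies ::
  "('k \<Rightarrow> 'd \<Rightarrow> (real^'m) set) \<Rightarrow> nat set \<Rightarrow> (nat \<Rightarrow> 'd) \<Rightarrow> 'k \<Rightarrow> (real^'m) set" where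
  "strategies X I \<omega> j = (\<Inter>i\<in>I. X j (\<omega> i))"

definition x_NE ::
  "('k::finite \<Rightarrow> real^'m^'k \<Rightarrow> real) \<Rightarrow> ('k \<Rightarrow> 'd \<Rightarrow> (real^'m) set) \<Rightarrow>
   nat set \<Rightarrow> (nat \<Rightarrow> 'd) \<Rightarrow> real^'m^'k" where
  "x_NE J X I \<omega> = (THE x. nash_equilibrium J (strategies X I \<omega>) x)"

definition support_constraints ::
  "('k::finite \<Rightarrow> real^'m^'k \<Rightarrow> real) \<Rightarrow> ('k \<Rightarrow> 'd \<Rightarrow> (real^'m) set) \<Rightarrow>
   nat \<Rightarrow> (nat \<Rightarrow> 'd) \<Rightarrow> nat set" where
  "support_constraints J X N \<omega> =
     {i \<in> {..<N}. x_NE J X ({..<N} - {i}) \<omega> \<noteq> x_NE J X {..<N} \<omega>}"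

definition sample_measure :: "'d measure \<Rightarrow> nat \<Rightarrow> (nat \<Rightarrow> 'd) measure" where
  "sample_measure P N = PiM {..<N} (\<lambda>_. P)"

definition risk ::
  "'d measure \<Rightarrow> ('k::finite \<Rightarrow> 'd \<Rightarrow> (real^'m) set) \<Rightarrow> real^'m^'k \<Rightarrow> real" where
  "risk P X x = measure P {\<delta> \<in> space P. x \<notin> profiles (\<lambda>j. X j \<delta>)}"

text \<open>
  The joint measurability of the constraint relation makes \<open>risk P X\<close> Borel; the constraint sets
  enter the solution maps only through their samples, so the second condition, for all \<open>N\<close>,
  also covers the games with constraints removed, and hence the number of support constraints.
\<close>

definition measurable_game ::
  "'d measure \<Rightarrow> ('k::finite \<Rightarrow> real^'m::finite^'k \<Rightarrow> real) \<Rightarrow>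
   ('k \<Rightarrow> 'd \<Rightarrow> (real^'m) set) \<Rightarrow> bool" where
  "measurable_game P J X \<longleftrightarrow>
     {(x, \<delta>). \<delta> \<in> space P \<and> x \<in> profiles (\<lambda>j. X j \<delta>)} \<in> sets (borel \<Otimes>\<^sub>M P) \<and>
     (\<forall>N. x_NE J X {..<N} \<in> borel_measurable (sample_measure P N))"

text \<open>For \<open>0 < \<beta> < 1\<close> and \<open>k < N\<close> the polynomial has exactly one root in \<open>(0, 1)\<close>.\<close>

definition t_root :: "nat \<Rightarrow> real \<Rightarrow> nat \<Rightarrow> real" where
  "t_root N \<beta> k =
     (if k < N
      then THE t. 0 < t \<and> t < 1 \<and>
             \<beta> / real (N + 1) * (\<Sum>l=k..N. real (l choose k) * t ^ (l - k))
               - real (N choose k) * t ^ (N - k) = 0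
      else 0)"

definition eps :: "nat \<Rightarrow> real \<Rightarrow> nat \<Rightarrow> real" where
  "eps N \<beta> k = 1 - t_root N \<beta> k"

end

theory Submission
  imports Defs
begin

text \<open>
  The Nash equilibria are the solutions of the variational inequality of the game operator on the
  product of the strategy sets, so they exist by Brouwer's theorem (after a truncation if the sets
  are unbounded) and are unique under strong monotonicity. An equilibrium that satisfies
  additional constraints remains the equilibrium when they are added. Helly's theorem, applied to
  the constraints and the open halfspace of descent directions at the equilibrium, shows that at
  most \<open>n\<close> constraints are of support.

  For the risk bounds, let \<open>q\<^sub>S\<close> be the probability that a new sample is satisfied by the
  equilibrium for the samples in \<open>S\<close>, and \<open>G\<^sub>S\<close> the event that all of \<open>S\<close> is of support for it. If
  a game is determined by its support constraints, the support for \<open>T\<close> is \<open>S\<close> exactly on \<open>G\<^sub>S\<close>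
  intersected with the event that the samples in \<open>T - S\<close> are satisfied by the equilibrium for \<open>S\<close>. By
  independence, summing \<open>E [G\<^sub>S q\<^sub>S ^ (card T - card S)]\<close> over \<open>S \<subseteq> T\<close> gives at most 1. Averaging over the
  sets \<open>T\<close> of size \<open>m\<close>, and then over \<open>m = 0, \<dots>, N\<close> with weights \<open>\<beta> / (N + 1)\<close>, produces the polynomial that
  defines \<open>t\<close>: the average is at most \<open>\<beta>\<close> and dominates the probability that \<open>q < t (s\<^sup>*)\<close>. The games with
  fewer than \<open>N\<close> samples are almost surely determined by their support constraints as well.
\<close>

section \<open>Variational inequalities and Nash equilibria\<close>

definition solves_vi :: "('a::real_inner \<Rightarrow> 'a) \<Rightarrow> 'a set \<Rightarrow> 'a \<Rightarrow> bool" where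
  "solves_vi F C x \<longleftrightarrow> x \<in> C \<and> (\<forall>y\<in>C. 0 \<le> F x \<bullet> (y - x))"

text \<open>Testing each solution against the other and adding the inequalities makes the
  monotonicity product nonpositive.\<close>

lemma solves_vi_unique:
  assumes "strongly_monotone_on C F" "solves_vi F C x" "solves_vi F C y"
  shows "x = y"
proof -
  obtain \<alpha> where \<alpha>: "\<alpha> > 0" "\<And>x y. x \<in> C \<Longrightarrow> y \<in> C \<Longrightarrow> (F x - F y) \<bullet> (x - y) \<ge> \<alpha> * (norm (x - y))\<^sup>2"
    using assms(1) unfolding strongly_monotone_on_def by blast
  have xy: "x \<in> C" "y \<in> C" "0 \<le> F x \<bullet> (y - x)" "0 \<le> F y \<bullet> (x - y)"
    using assms(2,3) by (auto simp: solves_vi_def)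
  have "\<alpha> * (norm (x - y))\<^sup>2 \<le> (F x - F y) \<bullet> (x - y)" using \<alpha>(2) xy by blast
  also have "\<dots> = - (F x \<bullet> (y - x)) - F y \<bullet> (x - y)"
    by (simp add: inner_diff_left inner_diff_right)
  also have "\<dots> \<le> 0" using xy by simp
  finally show ?thesis using \<alpha>(1) by (simp add: mult_le_0_iff)
qed

text \<open>A fixed point of the projected step
  \<open>x \<mapsto> closest_point C (x - F x)\<close>, which Brouwer's theorem provides, is a
  solution: the obtuse angle criterion of the projection applies to the residual
  \<open>- F x\<close>.\<close>

lemma solves_vi_exists_compact:
  fixes F :: "'a::euclidean_space \<Rightarrow> 'a"
  assumes "continuous_on C F" "compact C" "convex C" "C \<noteq> {}"
  shows "\<exists>x. solves_vi F C x"
proof -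
  have cl: "closed C" by (rule compact_imp_closed[OF assms(2)])
  let ?p = "\<lambda>x. closest_point C (x - F x)"
  have "continuous_on C ?p"
    by (rule continuous_on_compose2[OF continuous_on_closest_point[OF assms(3) cl assms(4), of UNIV]])
      (auto intro: continuous_on_diff[OF continuous_on_id assms(1)])
  moreover have "?p \<in> C \<rightarrow> C"
    using closest_point_in_set[OF cl assms(4)] by auto
  ultimately obtain x where x: "x \<in> C" "?p x = x"
    using brouwer[OF assms(2,3,4), of ?p] by blast
  have "0 \<le> F x \<bullet> (y - x)" if "y \<in> C" for y
    using closest_point_dot[OF assms(3) cl that, of "x - F x"] x by simp
  then show ?thesis using x by (auto simp: solves_vi_def)
qed

text \<open>Strong monotonicity confines the solutions of all truncations to a fixed ball around a
  feasible point; the solution on a larger ball is then interior to the truncation.\<close>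

lemma solves_vi_exists_strongly_monotone:
  fixes F :: "'a::euclidean_space \<Rightarrow> 'a"
  assumes "continuous_on C F" "closed C" "convex C" "C \<noteq> {}" "strongly_monotone_on C F"
  shows "\<exists>x. solves_vi F C x"
proof -
  obtain \<alpha> where \<alpha>: "\<alpha> > 0" "\<And>x y. x \<in> C \<Longrightarrow> y \<in> C \<Longrightarrow> (F x - F y) \<bullet> (x - y) \<ge> \<alpha> * (norm (x - y))\<^sup>2"
    using assms(5) unfolding strongly_monotone_on_def by blast
  obtain x0 where x0: "x0 \<in> C" using assms(4) by blast
  \<comment> \<open>The estimate below bounds the distance from \<open>x0\<close> by
    \<open>norm (F x0) / \<alpha>\<close>; the added 1 keeps the solution off the boundary of the
    ball.\<close>
  define R where "R = norm (F x0) / \<alpha> + 1"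
  have R: "R > 0" using \<alpha>(1) by (simp add: R_def add_nonneg_pos)
  let ?D = "C \<inter> cball x0 R"
  have "compact ?D" "convex ?D" "?D \<noteq> {}"
    using assms(2,3) x0 R by (auto simp: closed_Int_compact convex_Int)
  then obtain x where "solves_vi F ?D x"
    using solves_vi_exists_compact[of ?D F] continuous_on_subset[OF assms(1), of ?D] by blast
  then have x: "x \<in> C" "x \<in> cball x0 R" and vi: "\<And>y. y \<in> ?D \<Longrightarrow> 0 \<le> F x \<bullet> (y - x)"
    by (auto simp: solves_vi_def)
  have "0 \<le> F x \<bullet> (x0 - x)" using vi x0 R by simp
  then have "\<alpha> * (norm (x - x0))\<^sup>2 \<le> - (F x0 \<bullet> (x - x0))"
    using \<alpha>(2)[OF x(1) x0] by (simp add: inner_diff_left inner_diff_right)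
  also have "\<dots> \<le> norm (F x0) * norm (x - x0)"
    using Cauchy_Schwarz_ineq2[of "F x0" "x - x0"] by linarith
  finally have "norm (x - x0) * (\<alpha> * norm (x - x0)) \<le> norm (x - x0) * norm (F x0)"
    by (simp add: power2_eq_square ac_simps)
  then have "\<alpha> * norm (x - x0) \<le> norm (F x0)"
    by (cases "x = x0") auto
  then have "norm (x - x0) \<le> norm (F x0) / \<alpha>"
    using \<alpha>(1) by (simp add: field_simps)
  then have near: "norm (x - x0) < R" by (simp add: R_def)
  have "0 \<le> F x \<bullet> (y - x)" if y: "y \<in> C" for y
  proof -
    \<comment> \<open>Small enough that moving from \<open>x\<close> by the fraction
      \<open>s\<close> towards \<open>y\<close> stays in the ball; the 1 in the denominator covers
      \<open>y = x\<close>.\<close>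
    define s where "s = min 1 ((R - norm (x - x0)) / (norm (y - x) + 1))"
    have s: "0 < s" "s \<le> 1" using near by (auto simp: s_def add_nonneg_pos)
    have "s * norm (y - x) \<le> s * (norm (y - x) + 1)" using s by simp
    also have "\<dots> \<le> (R - norm (x - x0)) / (norm (y - x) + 1) * (norm (y - x) + 1)"
      by (intro mult_right_mono) (auto simp: s_def)
    also have "\<dots> = R - norm (x - x0)"
      using norm_ge_zero[of "y - x"] by (simp add: add_nonneg_eq_0_iff)
    finally have "norm (x - x0) + norm (s *\<^sub>R (y - x)) \<le> R" using s by simp
    then have "norm ((x - x0) + s *\<^sub>R (y - x)) \<le> R"
      using norm_triangle_ineq order_trans by blast
    then have "x + s *\<^sub>R (y - x) \<in> cball x0 R"
      by (simp add: dist_norm norm_minus_commute algebra_simps)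
    moreover have "x + s *\<^sub>R (y - x) = (1 - s) *\<^sub>R x + s *\<^sub>R y" by (simp add: algebra_simps)
    then have "x + s *\<^sub>R (y - x) \<in> C"
      using convexD_alt[OF assms(3) x(1) y, of s] s by simp
    ultimately have "0 \<le> F x \<bullet> (x + s *\<^sub>R (y - x) - x)" using vi by blast
    then show ?thesis using s by (simp add: zero_le_mult_iff)
  qed
  then show ?thesis using x(1) by (auto simp: solves_vi_def)
qed

text \<open>The halfspace of descent directions does not meet the feasible set; by Helly's theorem this
  is already caused by at most \<open>DIM('a)\<close> of the constraints.\<close>

lemma helly_active_constraints:
  fixes K :: "'i \<Rightarrow> 'a::euclidean_space set"
  assumes "finite I" "\<And>i. i \<in> I \<Longrightarrow> convex (K i)" "\<And>i. i \<in> I \<Longrightarrow> x \<in> K i"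
    and vi: "\<And>y. y \<in> (\<Inter>i\<in>I. K i) \<Longrightarrow> 0 \<le> c \<bullet> (y - x)"
  shows "\<exists>A\<subseteq>I. card A \<le> DIM('a) \<and> (\<forall>y\<in>(\<Inter>i\<in>A. K i). 0 \<le> c \<bullet> (y - x))"
proof -
  define H where "H = {y. c \<bullet> y < c \<bullet> x}"
  let ?f = "insert H (K ` I)"
  have xH: "x \<notin> H" by (simp add: H_def)
  have fin: "finite ?f" using assms(1) by simp
  have cv: "\<forall>s\<in>?f. convex s" using assms(2) by (auto simp: H_def convex_halfspace_lt)
  have H_iff: "y \<in> H \<longleftrightarrow> \<not> 0 \<le> c \<bullet> (y - x)" for y by (auto simp: H_def inner_diff_right)
  have "\<Inter>?f = {}" using vi H_iff by auto
  have "\<exists>t\<subseteq>?f. card t \<le> DIM('a) + 1 \<and> \<Inter>t = {}"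
  proof (cases "card ?f \<ge> DIM('a) + 1")
    case True
    then show ?thesis using Helly[of ?f] cv \<open>\<Inter>?f = {}\<close> by (metis le_refl)
  next
    case False
    then show ?thesis using \<open>\<Inter>?f = {}\<close> by (intro exI[of _ ?f]) auto
  qed
  then obtain t where t: "t \<subseteq> ?f" "card t \<le> DIM('a) + 1" "\<Inter>t = {}" by blast
  \<comment> \<open>Every constraint contains \<open>x\<close>, so an empty intersection must
    involve the halfspace. Discarding it removes the one set by which Helly's bound exceeds the
    dimension.\<close>
  have "H \<in> t"
  proof (rule ccontr)
    assume "H \<notin> t"
    then have "x \<in> \<Inter>t" using t(1) assms(3) by blast
    then show False using t(3) by simp
  qed
  have "t - {H} \<subseteq> K ` I" using t(1) by auto
  then obtain A where A: "A \<subseteq> I" "t - {H} = K ` A" "inj_on K A"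
    by (metis subset_image_inj)
  have "card A = card (t - {H})" using A card_image by metis
  also have "\<dots> \<le> DIM('a)" using t(2) \<open>H \<in> t\<close> finite_subset[OF t(1) fin] by simp
  finally have "card A \<le> DIM('a)" .
  moreover have "0 \<le> c \<bullet> (y - x)" if y: "y \<in> (\<Inter>i\<in>A. K i)" for y
  proof (rule ccontr)
    assume "\<not> 0 \<le> c \<bullet> (y - x)"
    then have "y \<in> H" using H_iff by blast
    moreover have "\<forall>s\<in>t - {H}. y \<in> s" unfolding A(2) using y by blast
    ultimately have "y \<in> \<Inter>t" by blast
    then show False using t(3) by simp
  qed
  ultimately show ?thesis using A(1) by blast
qed

text \<open>The one-sided difference quotient at 0 along the segment to \<open>y\<close> tends to
  \<open>g \<bullet> (y - x)\<close>. It is nonnegative at a minimum, and convexity bounds it by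
  \<open>f y - f x\<close>.\<close>

lemma convex_on_gderiv_minimum_iff:
  fixes f :: "'a::real_inner \<Rightarrow> real"
  assumes "convex_on UNIV f" "GDERIV f x :> g" "convex C" "x \<in> C"
  shows "(\<forall>y\<in>C. f x \<le> f y) \<longleftrightarrow> (\<forall>y\<in>C. 0 \<le> g \<bullet> (y - x))"
proof -
  define h where "h y s = f (x + s *\<^sub>R (y - x))" for y s
  have deriv: "(h y has_real_derivative g \<bullet> (y - x)) (at 0)" for y
  proof -
    have "(f has_derivative (\<lambda>v. v \<bullet> g)) (at (x + 0 *\<^sub>R (y - x)))"
      using assms(2) by (simp add: gderiv_def)
    then have "((\<lambda>s. f (x + s *\<^sub>R (y - x))) has_derivative (\<lambda>s. (s *\<^sub>R (y - x)) \<bullet> g)) (at 0)"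
      by (rule has_derivative_compose[rotated]) (auto intro!: derivative_eq_intros)
    then show ?thesis
      unfolding has_field_derivative_def h_def
      by (rule has_derivative_eq_rhs) (auto simp: fun_eq_iff inner_commute)
  qed
  have chord: "h y s \<le> f x + s * (f y - f x)" if "0 \<le> s" "s \<le> 1" for y s
  proof -
    have "h y s = f ((1 - s) *\<^sub>R x + s *\<^sub>R y)" by (simp add: h_def algebra_simps)
    also have "\<dots> \<le> (1 - s) * f x + s * f y"
      using assms(1) that by (intro convex_onD) auto
    finally show ?thesis by (simp add: algebra_simps)
  qed
  have quot: "((\<lambda>s. (h y s - f x) / s) \<longlongrightarrow> g \<bullet> (y - x)) (at_right 0)" for y
    using deriv[of y] by (simp add: has_field_derivative_iff h_def filterlim_at_split)
  have ev: "\<forall>\<^sub>F s in at_right 0. 0 < s \<and> s \<le> (1::real)"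
    by (auto simp: eventually_at_right_field intro: exI[of _ 1])
  show ?thesis
  proof safe
    fix y assume min: "\<forall>y\<in>C. f x \<le> f y" and y: "y \<in> C"
    show "0 \<le> g \<bullet> (y - x)"
    proof (rule tendsto_lowerbound[OF quot])
      show "\<forall>\<^sub>F s in at_right 0. 0 \<le> (h y s - f x) / s"
        using ev
      proof eventually_elim
        case (elim s)
        have "(1 - s) *\<^sub>R x + s *\<^sub>R y \<in> C"
          using convexD_alt[OF assms(3,4) y, of s] elim by simp
        then have "f x \<le> h y s" using min by (simp add: h_def algebra_simps)
        then show ?case using elim by simp
      qed
    qed simp
  next
    fix y assume vi: "\<forall>y\<in>C. 0 \<le> g \<bullet> (y - x)" and y: "y \<in> C"
    have "g \<bullet> (y - x) \<le> f y - f x"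
    proof (rule tendsto_upperbound[OF quot])
      show "\<forall>\<^sub>F s in at_right 0. (h y s - f x) / s \<le> f y - f x"
        using ev
      proof eventually_elim
        case (elim s)
        then show ?case using chord[of s y] by (simp add: field_simps)
      qed
    qed simp
    then show "f x \<le> f y" using vi y by fastforce
  qed
qed

section \<open>Gradients in the block of one agent\<close>

lemma deviate_nth: "deviate x j y $ i = (if i = j then y else x $ i)"
  by (simp add: deviate_def)

lemma deviate_same: "deviate x j (x $ j) = x"
  by (simp add: deviate_def vec_eq_iff)

lemma gderiv_deviate:
  fixes f :: "real^'m::finite^'k::finite \<Rightarrow> real"
  assumes "GDERIV f x :> g"
  shows "GDERIV (\<lambda>y. f (deviate x j y)) (x $ j) :> g $ j"
proof -
  have dev: "deviate x j y = x + axis j (y - x $ j)" for y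
    by (simp add: deviate_def axis_def vec_eq_iff)
  have ax: "bounded_linear (axis j :: real^'m \<Rightarrow> real^'m^'k)"
    unfolding linear_conv_bounded_linear[symmetric]
    by (rule linearI) (auto simp: axis_def vec_eq_iff)
  have "((\<lambda>y. x + axis j (y - x $ j)) has_derivative (\<lambda>v. axis j v)) (at (x $ j))"
    by (auto intro!: derivative_eq_intros bounded_linear.has_derivative[OF ax])
  then have "((\<lambda>y. deviate x j y) has_derivative (\<lambda>v. axis j v)) (at (x $ j))"
    by (simp only: dev)
  moreover have "(f has_derivative (\<lambda>v. v \<bullet> g)) (at (deviate x j (x $ j)))"
    using assms by (simp add: gderiv_def deviate_same)
  ultimately have "((\<lambda>y. f (deviate x j y)) has_derivative (\<lambda>v. axis j v \<bullet> g)) (at (x $ j))"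
    by (rule has_derivative_compose)
  then show ?thesis by (simp add: gderiv_def inner_axis')
qed

lemma gderiv_unique:
  fixes f :: "'a::real_inner \<Rightarrow> real"
  assumes "GDERIV f x :> g" "GDERIV f x :> h"
  shows "g = h"
proof -
  have "(\<lambda>v. v \<bullet> g) = (\<lambda>v. v \<bullet> h)"
    using assms has_derivative_unique unfolding gderiv_def by blast
  then have "(g - h) \<bullet> g = (g - h) \<bullet> h" by (rule fun_cong)
  then have "(g - h) \<bullet> (g - h) = 0" by (simp add: inner_diff_right)
  then show ?thesis by simp
qed

lemma partial_gradient_eq:
  assumes "GDERIV f x :> g"
  shows "partial_gradient j f x = g $ j"
  unfolding partial_gradient_def
  using gderiv_deviate[OF assms] gderiv_unique by blast

lemma continuous_on_game_operator:
  assumes "\<forall>j. continuously_differentiable (J j)"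
  shows "continuous_on S (game_operator J)"
proof -
  obtain g where g: "\<And>j x. GDERIV (J j) x :> g j x" "\<And>j. continuous_on UNIV (g j)"
    using assms unfolding continuously_differentiable_def by metis
  have "game_operator J = (\<lambda>x. \<chi> j. g j x $ j)"
    using partial_gradient_eq[OF g(1)] by (simp add: game_operator_def fun_eq_iff)
  then show ?thesis
    using g(2) by (auto intro!: continuous_intros intro: continuous_on_subset)
qed

lemma gderiv_own_strategy:
  assumes "continuously_differentiable (J j)"
  shows "GDERIV (\<lambda>y. J j (deviate x j y)) (x $ j) :> game_operator J x $ j"
proof -
  obtain g where "GDERIV (J j) x :> g"
    using assms unfolding continuously_differentiable_def by blast
  then show ?thesis
    using gderiv_deviate[of "J j" x g j] partial_gradient_eq[of "J j" x g j]
    by (simp add: game_operator_def)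
qed

section \<open>Product sets and the variational form of equilibria\<close>

lemma convex_profiles: "(\<And>j. convex (C j)) \<Longrightarrow> convex (profiles C)"
  by (auto simp: profiles_def convex_def)

lemma closed_profiles:
  assumes "\<And>j. closed (C j)"
  shows "closed (profiles C)"
proof -
  have "profiles C = (\<Inter>j. (\<lambda>x. x $ j) -` C j)" by (auto simp: profiles_def)
  then show ?thesis
    using assms by (auto intro!: closed_vimage_vec_nth)
qed

lemma nonempty_profiles:
  assumes "\<And>j. C j \<noteq> {}"
  shows "profiles C \<noteq> {}"
proof -
  have "(\<chi> j. SOME y. y \<in> C j) \<in> profiles C"
    using assms by (simp add: profiles_def some_in_eq)
  then show ?thesis by blast
qed

lemma bounded_profiles:
  assumes "\<And>j. bounded (C j)"
  shows "bounded (profiles C)"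
proof -
  obtain B where B: "\<And>j x. x \<in> C j \<Longrightarrow> norm x \<le> B j"
    using assms unfolding bounded_iff by metis
  have "norm x \<le> (\<Sum>j\<in>UNIV. B j)" if "x \<in> profiles C" for x
  proof -
    have "norm x \<le> (\<Sum>j\<in>UNIV. norm (x $ j))"
      unfolding norm_vec_def by (rule L2_set_le_sum) simp
    also have "\<dots> \<le> (\<Sum>j\<in>UNIV. B j)"
      using that B by (intro sum_mono) (auto simp: profiles_def)
    finally show ?thesis .
  qed
  then show ?thesis by (auto simp: bounded_iff)
qed

text \<open>Convexity turns the problem of each agent into a variational inequality in its own
  block. Summing over the blocks gives the joint inequality; conversely, a profile that differs from
  \<open>x\<close> in block \<open>j\<close> alone isolates that block.\<close>

lemma nash_equilibrium_iff_solves_vi: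
  assumes "\<forall>j. continuously_differentiable (J j)"
    and "\<forall>j x. convex_on UNIV (\<lambda>y. J j (deviate x j y))"
    and "\<And>j. convex (C j)"
  shows "nash_equilibrium J C x \<longleftrightarrow> solves_vi (game_operator J) (profiles C) x"
proof -
  have "(\<forall>j. \<forall>y\<in>C j. J j x \<le> J j (deviate x j y))
      \<longleftrightarrow> (\<forall>y\<in>profiles C. 0 \<le> game_operator J x \<bullet> (y - x))" if x: "x \<in> profiles C"
  proof -
    have own: "(\<forall>y\<in>C j. J j x \<le> J j (deviate x j y))
        \<longleftrightarrow> (\<forall>y\<in>C j. 0 \<le> game_operator J x $ j \<bullet> (y - x $ j))" for j
      using convex_on_gderiv_minimum_iff[OF assms(2)[rule_format, of j x]
          gderiv_own_strategy[of J j x, OF assms(1)[rule_format]] assms(3)[of j]] x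
      by (simp add: deviate_same profiles_def)
    have "(\<forall>j. \<forall>y\<in>C j. 0 \<le> game_operator J x $ j \<bullet> (y - x $ j))
        \<longleftrightarrow> (\<forall>y\<in>profiles C. 0 \<le> game_operator J x \<bullet> (y - x))"
    proof safe
      fix y assume "\<forall>j. \<forall>y\<in>C j. 0 \<le> game_operator J x $ j \<bullet> (y - x $ j)" "y \<in> profiles C"
      then show "0 \<le> game_operator J x \<bullet> (y - x)"
        by (simp add: inner_vec_def[of _ "y - x"] profiles_def sum_nonneg)
    next
      fix j y assume vi: "\<forall>y\<in>profiles C. 0 \<le> game_operator J x \<bullet> (y - x)" and y: "y \<in> C j"
      have "deviate x j y \<in> profiles C" using x y by (simp add: profiles_def deviate_nth)
      then have "0 \<le> game_operator J x \<bullet> (deviate x j y - x)" using vi by blast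
      also have "deviate x j y - x = axis j (y - x $ j)"
        by (simp add: deviate_def axis_def vec_eq_iff)
      finally show "0 \<le> game_operator J x $ j \<bullet> (y - x $ j)" by (simp add: inner_axis)
    qed
    then show ?thesis by (simp add: own)
  qed
  then show ?thesis by (auto simp: nash_equilibrium_def solves_vi_def)
qed

section \<open>The function t\<close>

text \<open>For \<open>k < l\<close>, passing from \<open>k\<close> to \<open>Suc k\<close>
  multiplies the ratio by \<open>(l - k) / (N - k)\<close>, which is at most 1.\<close>

lemma choose_ratio_antitone:
  assumes "l \<le> N" "k < N"
  shows "real (l choose Suc k) / real (N choose Suc k) \<le> real (l choose k) / real (N choose k)"
proof (cases "k < l")
  case False
  then have "l choose Suc k = 0" by (intro binomial_eq_0) simp
  then show ?thesis by (simp del: binomial_eq_0_iff)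
next
  case True
  have step: "real (Suc k) * real (n choose Suc k) = real (n - k) * real (n choose k)" for n
    by (metis binomial_absorb_comp binomial_absorption mult.commute of_nat_mult)
  have eq: "real (n choose Suc k) = real (n - k) * real (n choose k) / real (Suc k)" for n
    using step[of n] by (simp add: field_simps)
  have pos: "real (N choose k) > 0" "real (N - k) > 0"
    using assms by auto
  have "real (l choose Suc k) / real (N choose Suc k)
      = (real (l - k) / real (N - k)) * (real (l choose k) / real (N choose k))"
    unfolding eq by simp
  also have "\<dots> \<le> 1 * (real (l choose k) / real (N choose k))"
    using assms pos by (intro mult_right_mono) auto
  finally show ?thesis by simp
qed

definition root_poly :: "nat \<Rightarrow> real \<Rightarrow> nat \<Rightarrow> real \<Rightarrow> real" where
  "root_poly N \<beta> k t = \<beta> / real (N + 1) * (\<Sum>l=k..N. real (l choose k) * t ^ (l - k))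
     - real (N choose k) * t ^ (N - k)"

text \<open>Dividing the polynomial by its last monomial makes it strictly decreasing in \<open>t\<close> and
  decreasing in \<open>k\<close>.\<close>

definition root_quotient :: "nat \<Rightarrow> real \<Rightarrow> nat \<Rightarrow> real \<Rightarrow> real" where
  "root_quotient N \<beta> k t =
     \<beta> / real (N + 1) * (\<Sum>l=0..N. real (l choose k) / real (N choose k) * (1 / t) ^ (N - l))"

lemma root_poly_quotient:
  assumes "0 < t" "k \<le> N"
  shows "root_poly N \<beta> k t = real (N choose k) * t ^ (N - k) * (root_quotient N \<beta> k t - 1)"
proof -
  have pos: "real (N choose k) > 0" using assms by simp
  have "(\<Sum>l=k..N. real (l choose k) * t ^ (l - k))
      = (\<Sum>l=k..N. real (N choose k) * t ^ (N - k) *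
          (real (l choose k) / real (N choose k) * (1 / t) ^ (N - l)))"
  proof (rule sum.cong[OF refl])
    fix l assume l: "l \<in> {k..N}"
    then have "t ^ (N - k) = t ^ (l - k) * t ^ (N - l)"
      by (simp flip: power_add)
    then show "real (l choose k) * t ^ (l - k) = real (N choose k) * t ^ (N - k) *
          (real (l choose k) / real (N choose k) * (1 / t) ^ (N - l))"
      using pos assms by (simp add: power_one_over field_simps)
  qed
  \<comment> \<open>Terms with \<open>l < k\<close> vanish. A range independent of \<open>k\<close>
    allows the quotients for different \<open>k\<close> to be compared termwise.\<close>
  also have "\<dots> = (\<Sum>l=0..N. real (N choose k) * t ^ (N - k) *
          (real (l choose k) / real (N choose k) * (1 / t) ^ (N - l)))"
    by (rule sum.mono_neutral_left) auto
  also have "\<dots> = real (N choose k) * t ^ (N - k) *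
      (\<Sum>l=0..N. real (l choose k) / real (N choose k) * (1 / t) ^ (N - l))"
    by (rule sum_distrib_left[symmetric])
  finally have eq: "(\<Sum>l=k..N. real (l choose k) * t ^ (l - k)) = \<dots>" .
  show ?thesis
    unfolding root_poly_def root_quotient_def eq
    by (simp only: right_diff_distrib mult_1_right mult.left_commute mult.assoc)
qed

lemma root_quotient_strict_antitone:
  assumes "0 < s" "s < t" "k < N" "0 < \<beta>"
  shows "root_quotient N \<beta> k t < root_quotient N \<beta> k s"
proof -
  have inv: "1 / t < 1 / s" "0 < 1 / t" using assms by (auto simp: field_simps)
  have "(\<Sum>l=0..N. real (l choose k) / real (N choose k) * (1 / t) ^ (N - l))
      < (\<Sum>l=0..N. real (l choose k) / real (N choose k) * (1 / s) ^ (N - l))"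
  proof (rule sum_strict_mono_ex1)
    show "\<forall>l\<in>{0..N}. real (l choose k) / real (N choose k) * (1 / t) ^ (N - l)
        \<le> real (l choose k) / real (N choose k) * (1 / s) ^ (N - l)"
      using inv by (intro ballI mult_left_mono power_mono) auto
    have "(1 / t) ^ (N - k) < (1 / s) ^ (N - k)"
      using inv assms by (intro power_strict_mono) auto
    then show "\<exists>l\<in>{0..N}. real (l choose k) / real (N choose k) * (1 / t) ^ (N - l)
        < real (l choose k) / real (N choose k) * (1 / s) ^ (N - l)"
      using assms by (intro bexI[of _ k] mult_strict_left_mono) auto
  qed simp
  then show ?thesis
    unfolding root_quotient_def using assms by (intro mult_strict_left_mono) auto
qed

lemma root_quotient_antitone:
  assumes "0 < t" "k < N" "0 < \<beta>"
  shows "root_quotient N \<beta> (Suc k) t \<le> root_quotient N \<beta> k t"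
  unfolding root_quotient_def
  using assms choose_ratio_antitone[of _ N k]
  by (intro mult_left_mono sum_mono mult_right_mono) auto

text \<open>Intermediate value theorem: the value is \<open>\<beta> / (N + 1)\<close> at 0 and, by
  the hockey-stick identity, \<open>(N choose k) * (\<beta> / (k + 1) - 1)\<close> at 1.\<close>

lemma root_poly_root_exists:
  assumes "k < N" "0 < \<beta>" "\<beta> < 1"
  shows "\<exists>t. 0 < t \<and> t < 1 \<and> root_poly N \<beta> k t = 0"
proof -
  \<comment> \<open>At 0 only \<open>l = k\<close> survives, since \<open>0 ^ 0 = 1\<close>; the
    subtracted monomial vanishes because \<open>k < N\<close>.\<close>
  have "(\<Sum>l=k..N. real (l choose k) * 0 ^ (l - k)) = (\<Sum>l\<in>{k}. real (l choose k) * 0 ^ (l - k))"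
    using assms by (intro sum.mono_neutral_right) auto
  then have at0: "root_poly N \<beta> k 0 > 0"
    using assms by (simp add: root_poly_def power_0_left)
  have "(\<Sum>l=k..N. real (l choose k)) = real (\<Sum>l=0..N. l choose k)"
    by (simp, rule sum.mono_neutral_left) auto
  also have "\<dots> = real (Suc N choose Suc k)"
    by (simp only: sum_choose_upper atLeast0AtMost)
  finally have sum1: "(\<Sum>l=k..N. real (l choose k)) = real (Suc N choose Suc k)" .
  have "real (Suc k) * real (Suc N choose Suc k) = real (N + 1) * real (N choose k)"
    by (metis Suc_eq_plus1 Suc_times_binomial of_nat_mult)
  then have "root_poly N \<beta> k 1 = real (N choose k) * (\<beta> / real (Suc k) - 1)"
    unfolding root_poly_def by (simp add: sum1 field_simps del: binomial_Suc_Suc)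
  moreover have "\<beta> < real (Suc k)" using assms by simp
  then have "\<beta> / real (Suc k) - 1 < 0" by simp
  ultimately have at1: "root_poly N \<beta> k 1 < 0"
    using assms by (simp only: mult_less_0_iff) (simp add: zero_less_binomial_iff)
  have "continuous_on {0..1} (root_poly N \<beta> k)"
    unfolding root_poly_def by (intro continuous_intros)
  then obtain t where t: "0 \<le> t" "t \<le> 1" "root_poly N \<beta> k t = 0"
    using IVT2'[of "root_poly N \<beta> k" 1 0 0] at0 at1 by fastforce
  moreover have "t \<noteq> 0" "t \<noteq> 1" using t at0 at1 by auto
  ultimately show ?thesis by (intro exI[of _ t]) auto
qed

lemma root_poly_root_iff:
  assumes "k < N" "0 < t"
  shows "root_poly N \<beta> k t = 0 \<longleftrightarrow> root_quotient N \<beta> k t = 1"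
  using assms by (simp add: root_poly_quotient)

text \<open>Two roots would give the strictly decreasing quotient the value 1 twice, so the
  description in \<open>t_root\<close> denotes the only root.\<close>

lemma t_root_works:
  assumes "k < N" "0 < \<beta>" "\<beta> < 1"
  shows "0 < t_root N \<beta> k \<and> t_root N \<beta> k < 1 \<and> root_quotient N \<beta> k (t_root N \<beta> k) = 1"
proof -
  have "\<exists>!t. 0 < t \<and> t < 1 \<and> root_poly N \<beta> k t = 0"
  proof (rule ex_ex1I)
    fix s t assume st: "0 < s \<and> s < 1 \<and> root_poly N \<beta> k s = 0"
      "0 < t \<and> t < 1 \<and> root_poly N \<beta> k t = 0"
    then have "root_quotient N \<beta> k s = 1" "root_quotient N \<beta> k t = 1"
      using assms root_poly_root_iff by blast+
    then show "s = t"
      using root_quotient_strict_antitone[of s t k N \<beta>] root_quotient_strict_antitone[of t s k N \<beta>]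
        assms st by (cases s t rule: linorder_cases) auto
  qed (rule root_poly_root_exists[OF assms])
  from theI'[OF this] have "0 < t_root N \<beta> k \<and> t_root N \<beta> k < 1 \<and> root_poly N \<beta> k (t_root N \<beta> k) = 0"
    using assms(1) by (simp add: t_root_def root_poly_def)
  then show ?thesis using root_poly_root_iff[OF assms(1)] by blast
qed

lemma t_root_nonneg:
  assumes "0 < \<beta>" "\<beta> < 1"
  shows "0 \<le> t_root N \<beta> k"
  using t_root_works[OF _ assms, of k N] by (cases "k < N") (auto simp: t_root_def)

lemma t_root_antitone:
  assumes "0 < \<beta>" "\<beta> < 1" "k \<le> l"
  shows "t_root N \<beta> l \<le> t_root N \<beta> k"
proof -
  have step: "t_root N \<beta> (Suc k) \<le> t_root N \<beta> k" for k
  proof (cases "Suc k < N")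
    case False
    then have "t_root N \<beta> (Suc k) = 0" by (simp add: t_root_def)
    then show ?thesis using t_root_nonneg[OF assms(1,2)] by simp
  next
    case True
    let ?s = "t_root N \<beta> (Suc k)" and ?t = "t_root N \<beta> k"
    have s: "0 < ?s" "root_quotient N \<beta> (Suc k) ?s = 1" and
      t: "0 < ?t" "root_quotient N \<beta> k ?t = 1"
      using t_root_works[of "Suc k" N \<beta>] t_root_works[of k N \<beta>] True assms by auto
    \<comment> \<open>At the root for \<open>Suc k\<close> the quotient for \<open>k\<close> is
      still at least 1, so that root cannot lie to the right of the root for
      \<open>k\<close>.\<close>
    have "1 \<le> root_quotient N \<beta> k ?s"
      using root_quotient_antitone[of ?s k N \<beta>] s True assms by simp
    then show ?thesis
      using root_quotient_strict_antitone[of ?t ?s k N \<beta>] t True assms by force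
  qed
  show ?thesis
    by (rule lift_Suc_antimono_le[of "t_root N \<beta>", OF step assms(3)])
qed

text \<open>Left of the root the quotient exceeds 1, so the polynomial is nonnegative. The value
  \<open>t = 0\<close> is separate because the quotient divides by \<open>t\<close>; for
  \<open>k = N\<close> the bounds on \<open>t\<close> contradict
  \<open>t_root N \<beta> N = 0\<close>.\<close>

lemma below_t_root:
  assumes "0 < \<beta>" "\<beta> < 1" "0 \<le> t" "t < t_root N \<beta> k" "k \<le> N"
  shows "real (N choose k) * t ^ (N - k)
    \<le> \<beta> / real (N + 1) * (\<Sum>m=k..N. real (m choose k) * t ^ (m - k))"
proof (cases "t = 0 \<or> N \<le> k")
  case False
  then have t: "0 < t" "k < N" using assms by auto
  have "1 < root_quotient N \<beta> k t"
    using root_quotient_strict_antitone[of t "t_root N \<beta> k" k N \<beta>] t_root_works[of k N \<beta>] t assms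
    by auto
  then have "0 \<le> root_poly N \<beta> k t"
    using root_poly_quotient[of t k N \<beta>] t by simp
  then show ?thesis by (simp add: root_poly_def)
next
  case True
  then show ?thesis
  proof (cases "N \<le> k")
    case True
    then show ?thesis using assms by (simp add: t_root_def)
  next
    case False
    then have "t = 0" using True by simp
    then have "real (N choose k) * t ^ (N - k) = 0" using False by (simp add: power_0_left)
    also have "0 \<le> \<beta> / real (N + 1) * (\<Sum>m=k..N. real (m choose k) * t ^ (m - k))"
      using assms by (intro mult_nonneg_nonneg sum_nonneg) auto
    finally show ?thesis .
  qed
qed

section \<open>Scenario decisions\<close>

text \<open>\<open>sol S w\<close> is the solution computed from the samples \<open>w i\<close> with \<open>i \<in> S\<close>, and \<open>ok\<close> relates solutions
  to the samples whose constraint they satisfy.\<close>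

locale scenario = prob_space P for P :: "'d measure" +
  fixes N :: nat
    and sol :: "nat set \<Rightarrow> (nat \<Rightarrow> 'd) \<Rightarrow> 'x::{metric_space, second_countable_topology}"
    and ok :: "('x \<times> 'd) set"
  assumes ok_sets: "ok \<in> sets (borel \<Otimes>\<^sub>M P)"
    and sol_measurable: "S \<subseteq> {..<N} \<Longrightarrow> sol S \<in> borel_measurable (PiM {..<N} (\<lambda>_. P))"
    and sol_local: "S \<subseteq> {..<N} \<Longrightarrow> (\<And>i. i \<in> S \<Longrightarrow> w i = w' i) \<Longrightarrow> sol S w = sol S w'"
    and sol_feasible: "S \<subseteq> {..<N} \<Longrightarrow> w \<in> {..<N} \<rightarrow> space P \<Longrightarrow> i \<in> S \<Longrightarrow> (sol S w, w i) \<in> ok"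
    and sol_consistent: "S \<subseteq> T \<Longrightarrow> T \<subseteq> {..<N} \<Longrightarrow> w \<in> {..<N} \<rightarrow> space P \<Longrightarrow>
      (\<And>i. i \<in> T \<Longrightarrow> (sol S w, w i) \<in> ok) \<Longrightarrow> sol T w = sol S w"
begin

abbreviation M :: "(nat \<Rightarrow> 'd) measure" where
  "M \<equiv> PiM {..<N} (\<lambda>_. P)"

definition supp :: "nat set \<Rightarrow> (nat \<Rightarrow> 'd) \<Rightarrow> nat set" where
  "supp T w = {i \<in> T. sol (T - {i}) w \<noteq> sol T w}"

definition nondegenerate :: "nat set \<Rightarrow> (nat \<Rightarrow> 'd) \<Rightarrow> bool" where
  "nondegenerate T w \<longleftrightarrow> sol (supp T w) w = sol T w"

text \<open>Composed with \<open>sol S\<close>, this is the \<open>q\<close> of the overview: one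
  minus the risk.\<close>

definition mass :: "'x \<Rightarrow> real" where
  "mass x = measure P (Pair x -` ok)"

definition holds :: "nat set \<Rightarrow> nat \<Rightarrow> (nat \<Rightarrow> 'd) \<Rightarrow> real" where
  "holds S i w = indicator ok (sol S w, w i)"

lemma prob_space_M: "prob_space M"
  by (rule prob_space_PiM) (rule prob_space_axioms)

lemma space_M_Pi: "w \<in> space M \<Longrightarrow> w \<in> {..<N} \<rightarrow> space P"
  by (auto simp: space_PiM)

lemma mass_bounds: "0 \<le> mass x" "mass x \<le> 1"
  by (auto simp: mass_def)

lemma mass_measurable [measurable]: "mass \<in> borel_measurable borel"
proof -
  have "(\<lambda>x. emeasure P (Pair x -` ok)) \<in> borel_measurable borel"
    by (rule measurable_emeasure_Pair[OF ok_sets])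
  then show ?thesis unfolding mass_def measure_def by measurable
qed

lemma holds_measurable:
  assumes "S \<subseteq> {..<N}" "i < N"
  shows "holds S i \<in> borel_measurable M"
proof -
  have "(\<lambda>w. (sol S w, w i)) \<in> measurable M (borel \<Otimes>\<^sub>M P)"
    using sol_measurable[OF assms(1)] assms(2)
    by (intro measurable_Pair measurable_component_singleton) auto
  then show ?thesis
    unfolding holds_def using ok_sets by (rule measurable_compose[OF _ borel_measurable_indicator])
qed

lemma holds_bounds: "0 \<le> holds S i w" "holds S i w \<le> 1"
  by (auto simp: holds_def indicator_def)

lemma supp_subset: "supp T w \<subseteq> T"
  by (auto simp: supp_def)

lemma sol_update: "S \<subseteq> {..<N} \<Longrightarrow> i \<notin> S \<Longrightarrow> sol S (w(i := y)) = sol S w"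
  by (rule sol_local) auto

lemma supp_update: "S \<subseteq> {..<N} \<Longrightarrow> i \<notin> S \<Longrightarrow> supp S (w(i := y)) = supp S w"
proof -
  assume S: "S \<subseteq> {..<N}" "i \<notin> S"
  have "sol (S - {j}) (w(i := y)) = sol (S - {j}) w" for j
    using S by (intro sol_update) auto
  then show ?thesis by (simp add: supp_def sol_update[OF S])
qed

lemma nondegenerate_update:
  "S \<subseteq> {..<N} \<Longrightarrow> i \<notin> S \<Longrightarrow> nondegenerate S (w(i := y)) = nondegenerate S w"
proof -
  assume S: "S \<subseteq> {..<N}" "i \<notin> S"
  have "sol (supp S w) (w(i := y)) = sol (supp S w) w"
    using S supp_subset[of S w] by (intro sol_update) auto
  then show ?thesis by (simp only: nondegenerate_def supp_update[OF S] sol_update[OF S])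
qed

lemma sol_eq_measurable:
  assumes "S \<subseteq> {..<N}" "T \<subseteq> {..<N}"
  shows "Measurable.pred M (\<lambda>w. sol S w = sol T w)"
proof -
  note [measurable] = sol_measurable[OF assms(1)] sol_measurable[OF assms(2)]
  have "Measurable.pred M (\<lambda>w. dist (sol S w) (sol T w) = 0)" by measurable
  then show ?thesis by simp
qed

lemma supp_eq_measurable:
  assumes "T \<subseteq> {..<N}"
  shows "Measurable.pred M (\<lambda>w. supp T w = S)"
proof -
  have fin: "finite T" using assms finite_subset by blast
  have [measurable]: "Measurable.pred M (\<lambda>w. sol (T - {i}) w = sol T w)" for i
    using assms by (intro sol_eq_measurable) auto
  have "supp T w = S \<longleftrightarrow> S \<subseteq> T \<and> (\<forall>i\<in>T. i \<in> S \<longleftrightarrow> \<not> sol (T - {i}) w = sol T w)" for w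
    by (auto simp: supp_def)
  then show ?thesis
    using fin countable_finite by (simp only:) measurable
qed

lemma nondegenerate_measurable:
  assumes "T \<subseteq> {..<N}"
  shows "Measurable.pred M (nondegenerate T)"
proof -
  have fin: "finite (Pow T)" using assms finite_subset by blast
  \<comment> \<open>The index set \<open>supp T w\<close> is random; splitting over its finitely
    many values leaves fixed index sets.\<close>
  have eq: "nondegenerate T = (\<lambda>w. \<exists>S\<in>Pow T. supp T w = S \<and> sol S w = sol T w)"
    using supp_subset by (auto simp: nondegenerate_def fun_eq_iff)
  show ?thesis
    unfolding eq using assms
    by (intro pred_intros_finite(4)[OF fin] pred_intros_logic supp_eq_measurable sol_eq_measurable) auto
qed

section \<open>Integrating out fresh samples\<close>

lemma integrable_bounded:
  fixes h :: "(nat \<Rightarrow> 'd) \<Rightarrow> real"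
  assumes "h \<in> borel_measurable M" "\<And>w. 0 \<le> h w" "\<And>w. h w \<le> 1"
  shows "integrable M h"
proof -
  interpret M: prob_space M by (rule prob_space_M)
  show ?thesis
    using assms by (intro M.integrable_const_bound[where B=1]) auto
qed

text \<open>Fubini with coordinate \<open>i\<close> innermost: \<open>h\<close> and
  \<open>sol S\<close> ignore it, so the inner integral of \<open>holds\<close> is the mass.\<close>

lemma integral_fresh_sample:
  assumes S: "S \<subseteq> {..<N}" "i < N" "i \<notin> S"
    and h: "h \<in> borel_measurable M" "\<And>w. 0 \<le> h w" "\<And>w. h w \<le> 1"
    and h_local: "\<And>w y. h (w(i := y)) = h w"
  shows "(\<integral>w. h w * holds S i w \<partial>M) = (\<integral>w. h w * mass (sol S w) \<partial>M)"
proof -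
  interpret product_sigma_finite "\<lambda>_::nat. P"
    by unfold_locales
  have ins: "{..<N} = insert i ({..<N} - {i})" using S by auto
  note [measurable] = h(1) holds_measurable[OF S(1,2)] sol_measurable[OF S(1)]
  have "integrable M (\<lambda>w. h w * holds S i w)"
    using h(2,3) holds_bounds by (intro integrable_bounded) (auto intro: mult_le_one)
  then have "(\<integral>w. h w * holds S i w \<partial>M) =
      (\<integral>w. (\<integral>y. h (w(i := y)) * holds S i (w(i := y)) \<partial>P) \<partial>PiM ({..<N} - {i}) (\<lambda>_. P))"
    by (subst (1) ins, subst product_integral_insert) (use ins in auto)
  also have "\<dots> = (\<integral>w. h w * mass (sol S w) \<partial>PiM ({..<N} - {i}) (\<lambda>_. P))"
  proof (rule arg_cong[where f="integral\<^sup>L _"], rule ext)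
    fix w
    have "Pair (sol S w) -` ok \<in> sets P" by (rule sets_Pair1[OF ok_sets])
    moreover have "holds S i (w(i := y)) = indicator (Pair (sol S w) -` ok) y" for y
      using sol_update[OF S(1,3)] by (simp add: holds_def indicator_def)
    ultimately show "(\<integral>y. h (w(i := y)) * holds S i (w(i := y)) \<partial>P) = h w * mass (sol S w)"
      by (simp add: h_local mass_def)
  qed
  also have "\<dots> = (\<integral>w. (\<integral>y. h (w(i := y)) * mass (sol S (w(i := y))) \<partial>P)
      \<partial>PiM ({..<N} - {i}) (\<lambda>_. P))"
    by (simp add: h_local sol_update[OF S(1,3)] prob_space)
  also have "\<dots> = (\<integral>w. h w * mass (sol S w) \<partial>M)"
  proof -
    have "integrable M (\<lambda>w. h w * mass (sol S w))"
      using h(2,3) mass_bounds by (intro integrable_bounded) (auto intro: mult_le_one)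
    then show ?thesis
      by (subst (2) ins, subst product_integral_insert) (use ins in auto)
  qed
  finally show ?thesis .
qed

text \<open>Samples are integrated out one by one. The weight \<open>h\<close> is general because
  each step turns one factor \<open>holds\<close> into a factor \<open>mass (sol S w)\<close> that
  joins the weight.\<close>

lemma integral_fresh_samples:
  assumes "finite D" "S \<subseteq> {..<N}" "D \<subseteq> {..<N} - S"
    and "h \<in> borel_measurable M" "\<And>w. 0 \<le> h w" "\<And>w. h w \<le> 1"
    and "\<And>w y i. i \<notin> S \<Longrightarrow> h (w(i := y)) = h w"
  shows "(\<integral>w. h w * (\<Prod>i\<in>D. holds S i w) \<partial>M) = (\<integral>w. h w * mass (sol S w) ^ card D \<partial>M)"
  using assms
proof (induction D arbitrary: h rule: finite_induct)
  case empty
  then show ?case by simp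
next
  case (insert i D)
  let ?pr = "\<lambda>w. \<Prod>j\<in>D. holds S j w"
  have pr: "0 \<le> ?pr w" "?pr w \<le> 1" for w
    using holds_bounds by (auto intro: prod_nonneg prod_le_1)
  have i: "i < N" "i \<notin> S" using insert.prems by auto
  note [measurable] = insert.prems(3) sol_measurable[OF insert.prems(1)]
  have [measurable]: "?pr \<in> borel_measurable M"
    using insert.prems(1,2) by (intro borel_measurable_prod holds_measurable) auto
  have "(\<integral>w. h w * (\<Prod>j\<in>insert i D. holds S j w) \<partial>M)
      = (\<integral>w. (h w * ?pr w) * holds S i w \<partial>M)"
    using insert.hyps by (simp add: mult_ac)
  also have "\<dots> = (\<integral>w. (h w * ?pr w) * mass (sol S w) \<partial>M)"
  proof (rule integral_fresh_sample[OF insert.prems(1) i])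
    fix w y
    have "holds S j (w(i := y)) = holds S j w" if "j \<in> D" for j
      using that insert.hyps sol_update[OF insert.prems(1) i(2)] by (auto simp: holds_def)
    then have "?pr (w(i := y)) = ?pr w" by (intro prod.cong refl)
    then show "h (w(i := y)) * ?pr (w(i := y)) = h w * ?pr w"
      by (simp only: insert.prems(6)[OF i(2)])
  qed (use insert.prems(4,5) pr in \<open>auto intro: mult_le_one\<close>)
  also have "\<dots> = (\<integral>w. (h w * mass (sol S w)) * ?pr w \<partial>M)"
    by (simp add: mult_ac)
  also have "\<dots> = (\<integral>w. (h w * mass (sol S w)) * mass (sol S w) ^ card D \<partial>M)"
  proof (rule insert.IH[OF insert.prems(1)])
    show "h (w(j := y)) * mass (sol S (w(j := y))) = h w * mass (sol S w)" if "j \<notin> S" for w y j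
      by (simp only: insert.prems(6)[OF that] sol_update[OF insert.prems(1) that])
  qed (use insert.prems(2,4,5) mass_bounds in \<open>auto intro: mult_le_one\<close>)
  finally show ?case using insert.hyps by (simp add: mult_ac)
qed

text \<open>If \<open>j \<in> T\<close> is redundant for \<open>T\<close>, then
  \<open>sol (T - {j}) w = sol T w\<close> also satisfies sample \<open>i\<close>, and consistency
  carries the equality over to \<open>insert i T\<close>.\<close>

lemma supp_extend_subset:
  assumes "insert i T \<subseteq> {..<N}" "i \<notin> T" "w \<in> {..<N} \<rightarrow> space P" "(sol T w, w i) \<in> ok"
  shows "sol (insert i T) w = sol T w" "supp (insert i T) w \<subseteq> supp T w"
proof -
  have T: "T \<subseteq> {..<N}" using assms by auto
  show eq: "sol (insert i T) w = sol T w"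
    using sol_feasible[OF T assms(3)] assms by (intro sol_consistent) auto
  show "supp (insert i T) w \<subseteq> supp T w"
  proof
    fix j assume "j \<in> supp (insert i T) w"
    then have j: "j \<in> insert i T" "sol (insert i T - {j}) w \<noteq> sol T w" by (auto simp: supp_def eq)
    then have "j \<noteq> i" using assms(2) by auto
    then have jT: "j \<in> T" and minus: "insert i T - {j} = insert i (T - {j})" using j by auto
    have "sol (T - {j}) w \<noteq> sol T w"
    proof
      assume "sol (T - {j}) w = sol T w"
      then have "sol (insert i (T - {j})) w = sol (T - {j}) w"
        using sol_feasible[OF T assms(3)] assms by (intro sol_consistent) auto
      then show False using j \<open>sol (T - {j}) w = sol T w\<close> minus by simp
    qed
    then show "j \<in> supp T w" using jT by (simp add: supp_def)
  qed
qed

text \<open>The support for \<open>insert i T\<close> lies in \<open>supp T w\<close> and already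
  yields \<open>sol T w\<close>, which satisfies all of \<open>T\<close>; consistency adds the
  missing support samples without changing it.\<close>

lemma nondegenerate_shrink:
  assumes "insert i T \<subseteq> {..<N}" "i \<notin> T" "w \<in> {..<N} \<rightarrow> space P" "(sol T w, w i) \<in> ok"
    and "nondegenerate (insert i T) w"
  shows "nondegenerate T w"
proof -
  let ?U = "insert i T"
  have T: "T \<subseteq> {..<N}" using assms by auto
  note ext = supp_extend_subset[OF assms(1-4)]
  have eq: "sol (supp ?U w) w = sol T w"
    using assms(5) ext(1) by (simp add: nondegenerate_def)
  have "sol (supp T w) w = sol (supp ?U w) w"
  proof (rule sol_consistent[OF ext(2)])
    show "supp T w \<subseteq> {..<N}" using T supp_subset by blast
    show "(sol (supp ?U w) w, w j) \<in> ok" if "j \<in> supp T w" for j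
      unfolding eq using sol_feasible[OF T assms(3)] that supp_subset by blast
  qed (rule assms(3))
  then show ?thesis by (simp add: nondegenerate_def eq)
qed

text \<open>Sample \<open>j\<close> is independent of the solution for the others, so where
  \<open>mass\<close> vanishes it is satisfied with probability zero.\<close>

lemma AE_no_null_feasible:
  assumes "T \<subseteq> {..<N}" "j \<in> T"
  shows "AE w in M. \<not> (mass (sol (T - {j}) w) = 0 \<and> (sol (T - {j}) w, w j) \<in> ok)"
proof -
  let ?S = "T - {j}"
  let ?h = "\<lambda>w. of_bool (mass (sol ?S w) = 0) :: real"
  have S: "?S \<subseteq> {..<N}" "j < N" "j \<notin> ?S" using assms by auto
  note [measurable] = sol_measurable[OF S(1)] holds_measurable[OF S(1,2)]
  have hm [measurable]: "?h \<in> borel_measurable M" by measurable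
  have "(\<integral>w. ?h w * holds ?S j w \<partial>M) = (\<integral>w. ?h w * mass (sol ?S w) \<partial>M)"
    using sol_update[OF S(1,3)] by (intro integral_fresh_sample[OF S hm]) auto
  also have "\<dots> = (\<integral>w. 0 \<partial>M)" by (intro Bochner_Integration.integral_cong) auto
  also have "\<dots> = 0" by simp
  finally have "(\<integral>w. ?h w * holds ?S j w \<partial>M) = 0" .
  moreover have "integrable M (\<lambda>w. ?h w * holds ?S j w)"
    using holds_bounds by (intro integrable_bounded) (auto intro: mult_le_one)
  ultimately have "AE w in M. ?h w * holds ?S j w = 0"
    using holds_bounds by (subst (asm) integral_nonneg_eq_0_iff_AE) auto
  then show ?thesis
    by eventually_elim (auto simp: holds_def)
qed

text \<open>If degeneracy for \<open>T\<close> survived the addition of a fresh sample with positive probability, it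
  would show for \<open>insert i T\<close>. So almost every degenerate solution for \<open>T\<close> is violated by almost
  every new sample; but such a solution cannot come from \<open>T\<close> without one of its samples and
  satisfy that sample as well.\<close>

lemma AE_nondegenerate_shrink:
  assumes "insert i T \<subseteq> {..<N}" "i \<notin> T"
    and "AE w in M. nondegenerate (insert i T) w"
  shows "AE w in M. nondegenerate T w"
proof -
  have T: "T \<subseteq> {..<N}" "i < N" using assms by auto
  let ?h = "\<lambda>w. of_bool (\<not> nondegenerate T w) :: real"
  note [measurable] = sol_measurable[OF T(1)] nondegenerate_measurable[OF T(1)]
  have hm [measurable]: "?h \<in> borel_measurable M" by measurable
  \<comment> \<open>By independence this is the probability that the solution for \<open>T\<close>
    is degenerate and satisfies sample \<open>i\<close>; by \<open>nondegenerate_shrink\<close> the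
    enlarged set would then be degenerate too.\<close>
  have "(\<integral>w. ?h w * mass (sol T w) \<partial>M) = (\<integral>w. ?h w * holds T i w \<partial>M)"
    using nondegenerate_update[OF T(1) assms(2)]
    by (intro integral_fresh_sample[OF T(1,2) assms(2) hm, symmetric]) auto
  also have "\<dots> = 0"
  proof (rule integral_eq_zero_AE)
    show "AE w in M. ?h w * holds T i w = 0"
      using assms(3) AE_space
    proof eventually_elim
      case (elim w)
      then show ?case
        using nondegenerate_shrink[OF assms(1,2) space_M_Pi[OF elim(2)] _ elim(1)]
        by (auto simp: holds_def indicator_def)
    qed
  qed
  finally have int0: "(\<integral>w. ?h w * mass (sol T w) \<partial>M) = 0" .
  have "integrable M (\<lambda>w. ?h w * mass (sol T w))"
    using mass_bounds by (intro integrable_bounded) (auto intro: mult_le_one)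
  then have "AE w in M. ?h w * mass (sol T w) = 0"
    using mass_bounds int0 by (subst (asm) integral_nonneg_eq_0_iff_AE) auto
  moreover have "AE w in M. \<forall>j\<in>T. \<not> (mass (sol (T - {j}) w) = 0 \<and> (sol (T - {j}) w, w j) \<in> ok)"
    using AE_no_null_feasible[OF T(1)] finite_subset[OF T(1)] by (simp add: AE_finite_all)
  ultimately show ?thesis
    using AE_space
  proof eventually_elim
    case (elim w)
    show ?case
    proof (rule ccontr)
      assume deg: "\<not> nondegenerate T w"
      then have "supp T w \<noteq> T" by (auto simp: nondegenerate_def)
      then obtain j where j: "j \<in> T" "sol (T - {j}) w = sol T w" by (auto simp: supp_def)
      moreover have "(sol T w, w j) \<in> ok"
        using sol_feasible[OF T(1) space_M_Pi[OF elim(3)] j(1)] .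
      ultimately show False using elim(1,2) deg by auto
    qed
  qed
qed

lemma AE_nondegenerate:
  assumes "AE w in M. nondegenerate {..<N} w" "T \<subseteq> {..<N}"
  shows "AE w in M. nondegenerate T w"
proof -
  have "AE w in M. nondegenerate ({..<N} - D) w" if "finite D" "D \<subseteq> {..<N}" for D
    using that
  proof (induction D)
    case empty
    then show ?case using assms(1) by simp
  next
    case (insert i D)
    then have eq: "insert i ({..<N} - insert i D) = {..<N} - D" by auto
    show ?case
    proof (rule AE_nondegenerate_shrink[of i])
      show "AE w in M. nondegenerate (insert i ({..<N} - insert i D)) w"
        unfolding eq using insert by simp
    qed (use insert.prems in auto)
  qed
  from this[of "{..<N} - T"] show ?thesis
    using assms(2) by (simp add: double_diff)
qed

text \<open>Up to null sets, \<open>supp T w = S\<close> means that \<open>compression S w = 1\<close> and that the samples in \<open>T - S\<close>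
  satisfy the solution for \<open>S\<close>, of which they are independent.\<close>

definition compression :: "nat set \<Rightarrow> (nat \<Rightarrow> 'd) \<Rightarrow> real" where
  "compression S w = of_bool (supp S w = S)"

lemma compression_measurable:
  "S \<subseteq> {..<N} \<Longrightarrow> compression S \<in> borel_measurable M"
  unfolding compression_def using supp_eq_measurable[of S S] by measurable

lemma compression_update:
  "S \<subseteq> {..<N} \<Longrightarrow> i \<notin> S \<Longrightarrow> compression S (w(i := y)) = compression S w"
  by (simp add: compression_def supp_update)

text \<open>All index sets between \<open>S\<close> and \<open>T\<close> have the solution for
  \<open>S\<close>, so nothing outside \<open>S\<close> is of support for \<open>T\<close>.\<close>

lemma supp_eq_if_compression:
  assumes "S \<subseteq> T" "T \<subseteq> {..<N}" "w \<in> {..<N} \<rightarrow> space P" "nondegenerate T w"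
    and "supp S w = S" "\<And>i. i \<in> T - S \<Longrightarrow> (sol S w, w i) \<in> ok"
  shows "supp T w = S"
proof -
  have S: "S \<subseteq> {..<N}" using assms by auto
  have ok: "(sol S w, w i) \<in> ok" if "i \<in> T" for i
    using that assms(6) sol_feasible[OF S assms(3)] by blast
  have eq: "sol U w = sol S w" if "S \<subseteq> U" "U \<subseteq> T" for U
    using that ok assms by (intro sol_consistent) auto
  have "supp T w \<subseteq> S"
  proof
    fix i assume i: "i \<in> supp T w"
    show "i \<in> S"
    proof (rule ccontr)
      assume "i \<notin> S"
      then have "sol (T - {i}) w = sol S w" "sol T w = sol S w"
        using assms(1) by (intro eq; auto)+
      then show False using i by (simp add: supp_def)
    qed
  qed
  moreover have "i \<in> supp T w" if i: "i \<in> S" for i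
  proof (rule ccontr)
    assume "i \<notin> supp T w"
    \<comment> \<open>The solution for \<open>S\<close> would already come from a subset of
      \<open>S - {i}\<close>, and consistency would make \<open>i\<close> redundant in
      \<open>S\<close>, contrary to \<open>supp S w = S\<close>.\<close>
    then have sub: "supp T w \<subseteq> S - {i}" using \<open>supp T w \<subseteq> S\<close> by auto
    have comp: "sol (supp T w) w = sol S w"
      using assms(1,4) eq[of T] by (simp add: nondegenerate_def)
    then have "sol (S - {i}) w = sol (supp T w) w"
      using sub S assms(1,3) ok by (intro sol_consistent) auto
    then show False using comp assms(5) i by (auto simp: supp_def)
  qed
  ultimately show ?thesis by blast
qed

text \<open>If some \<open>i\<close> were redundant in the support, the solution for
  \<open>T\<close> would come from the support without \<open>i\<close>; satisfying all of
  \<open>T\<close>, it would also be the solution for \<open>T - {i}\<close>.\<close>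

lemma compression_if_supp_eq:
  assumes "T \<subseteq> {..<N}" "w \<in> {..<N} \<rightarrow> space P" "nondegenerate T w"
  shows "supp (supp T w) w = supp T w"
proof -
  let ?S = "supp T w"
  have S: "?S \<subseteq> T" by (rule supp_subset)
  have eq: "sol ?S w = sol T w" using assms(3) by (simp add: nondegenerate_def)
  have "sol (?S - {i}) w \<noteq> sol ?S w" if i: "i \<in> ?S" for i
  proof
    assume "sol (?S - {i}) w = sol ?S w"
    then have "sol (T - {i}) w = sol (?S - {i}) w"
      using sol_feasible[OF assms(1,2)] S assms(1,2) eq by (intro sol_consistent) auto
    then show False using i eq \<open>sol (?S - {i}) w = sol ?S w\<close> by (simp add: supp_def)
  qed
  then show ?thesis by (auto simp: supp_def[of ?S])
qed

section \<open>Weights of candidate supports\<close>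

lemma prod_holds: "finite D \<Longrightarrow> (\<Prod>i\<in>D. holds S i w) = of_bool (\<forall>i\<in>D. (sol S w, w i) \<in> ok)"
  by (induction D rule: finite_induct) (auto simp: holds_def)

text \<open>If solutions are almost surely nondegenerate and \<open>card S \<le> m \<le> N\<close>,
  this is the probability that \<open>S\<close> is the support for a given set of \<open>m\<close>
  samples containing \<open>S\<close>. It depends on that set only through its size.\<close>

definition weight :: "nat set \<Rightarrow> nat \<Rightarrow> real" where
  "weight S m = (\<integral>w. compression S w * mass (sol S w) ^ (m - card S) \<partial>M)"

lemma compression_bounds: "0 \<le> compression S w" "compression S w \<le> 1"
  by (auto simp: compression_def)

text \<open>For almost every sample at most one integrand is nonzero, the one of the actual support
  \<open>supp T w\<close>.\<close>

lemma sum_weight_le_1: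
  assumes "AE w in M. nondegenerate {..<N} w" "T \<subseteq> {..<N}"
  shows "(\<Sum>S\<in>Pow T. weight S (card T)) \<le> 1"
proof -
  interpret M: prob_space M by (rule prob_space_M)
  have fin: "finite T" using assms(2) finite_subset by blast
  let ?f = "\<lambda>S w. compression S w * (\<Prod>i\<in>T - S. holds S i w)"
  have f_int: "integrable M (?f S)" if "S \<in> Pow T" for S
  proof (rule integrable_bounded)
    show "?f S \<in> borel_measurable M"
      using that assms(2)
      by (intro borel_measurable_times borel_measurable_prod holds_measurable compression_measurable) auto
    show "?f S w \<le> 1" for w
      using compression_bounds holds_bounds by (auto intro!: mult_le_one prod_nonneg prod_le_1)
  qed (auto intro!: mult_nonneg_nonneg prod_nonneg compression_bounds holds_bounds)
  have "weight S (card T) = (\<integral>w. ?f S w \<partial>M)" if "S \<in> Pow T" for S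
  proof -
    have S: "S \<subseteq> {..<N}" "card (T - S) = card T - card S"
      using that assms(2) fin by (auto simp: card_Diff_subset finite_subset)
    have "T - S \<subseteq> {..<N} - S" "finite (T - S)" using assms(2) fin by auto
    then show ?thesis
      unfolding weight_def S(2)[symmetric]
      by (intro integral_fresh_samples[symmetric] S compression_measurable compression_bounds
          compression_update)
  qed
  then have "(\<Sum>S\<in>Pow T. weight S (card T)) = (\<integral>w. (\<Sum>S\<in>Pow T. ?f S w) \<partial>M)"
    using f_int by (subst Bochner_Integration.integral_sum) auto
  also have "\<dots> \<le> (\<integral>w. 1 \<partial>M)"
  proof (rule integral_mono_AE)
    show "AE w in M. (\<Sum>S\<in>Pow T. ?f S w) \<le> 1"
      using AE_nondegenerate[OF assms] AE_space
    proof eventually_elim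
      case (elim w)
      have "?f S w = 0" if "S \<in> Pow T" "S \<noteq> supp T w" for S
        using supp_eq_if_compression[of S T w] that elim assms(2) space_M_Pi fin
        by (auto simp: compression_def prod_holds)
      then have "(\<Sum>S\<in>Pow T. ?f S w) = (\<Sum>S\<in>{supp T w}. ?f S w)"
        using fin supp_subset by (intro sum.mono_neutral_right) auto
      also have "\<dots> = ?f (supp T w) w" by simp
      also have "\<dots> \<le> 1"
        using compression_bounds holds_bounds by (intro mult_le_one prod_nonneg prod_le_1) auto
      finally show ?case .
    qed
  qed (use f_int in auto)
  finally show ?thesis by (simp add: M.prob_space)
qed

lemma card_supersets:
  assumes "S \<subseteq> {..<N}" "card S \<le> m"
  shows "card {T. S \<subseteq> T \<and> T \<subseteq> {..<N} \<and> card T = m} = (N - card S) choose (m - card S)"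
proof -
  have finS: "finite S" using assms(1) finite_subset by blast
  have "bij_betw (\<lambda>D. D \<union> S) {D. D \<subseteq> {..<N} - S \<and> card D = m - card S}
      {T. S \<subseteq> T \<and> T \<subseteq> {..<N} \<and> card T = m}"
  proof (rule bij_betw_byWitness[where f'="\<lambda>T. T - S"])
    show "(\<lambda>D. D \<union> S) ` {D. D \<subseteq> {..<N} - S \<and> card D = m - card S}
        \<subseteq> {T. S \<subseteq> T \<and> T \<subseteq> {..<N} \<and> card T = m}"
    proof safe
      fix D assume D: "D \<subseteq> {..<N} - S" "card D = m - card S"
      then have "finite D" using finite_subset by blast
      then show "card (D \<union> S) = m" using D finS assms(2) by (subst card_Un_disjoint) auto
    qed (use assms(1) in auto)
    show "(\<lambda>T. T - S) ` {T. S \<subseteq> T \<and> T \<subseteq> {..<N} \<and> card T = m}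
        \<subseteq> {D. D \<subseteq> {..<N} - S \<and> card D = m - card S}"
      using finS by (auto simp: card_Diff_subset)
  qed auto
  then have "card {T. S \<subseteq> T \<and> T \<subseteq> {..<N} \<and> card T = m}
      = card {D. D \<subseteq> {..<N} - S \<and> card D = m - card S}"
    by (rule bij_betw_same_card[symmetric])
  also have "\<dots> = card ({..<N} - S) choose (m - card S)" by (rule n_subsets) simp
  finally show ?thesis using assms(1) finS by (simp add: card_Diff_subset)
qed

text \<open>Averages \<open>sum_weight_le_1\<close> over the sets \<open>T\<close> of size \<open>m\<close>: a fixed \<open>S\<close> lies in a fraction
  \<open>(m choose card S) / (N choose card S)\<close> of them.\<close>

lemma weighted_sum_le_1:
  assumes "AE w in M. nondegenerate {..<N} w" "m \<le> N"
  shows "(\<Sum>S\<in>Pow {..<N}. real (m choose card S) / real (N choose card S) * weight S m) \<le> 1"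
proof -
  let ?A = "{T \<in> Pow {..<N}. card T = m}"
  have cardA: "card ?A = N choose m"
    by (simp only: Pow_iff n_subsets[OF finite_lessThan] card_lessThan)
  have "(\<Sum>T\<in>?A. \<Sum>S\<in>Pow T. weight S m) \<le> (\<Sum>T\<in>?A. 1)"
    using sum_weight_le_1[OF assms(1)] by (intro sum_mono) auto
  also have "\<dots> = real (N choose m)" by (simp only: sum_constant cardA mult_1_right)
  finally have le: "(\<Sum>T\<in>?A. \<Sum>S\<in>Pow T. weight S m) \<le> real (N choose m)" .
  have "(\<Sum>T\<in>?A. \<Sum>S\<in>Pow T. weight S m) = (\<Sum>T\<in>?A. \<Sum>S\<in>{S \<in> Pow {..<N}. S \<subseteq> T}. weight S m)"
    by (intro sum.cong refl) auto
  also have "\<dots> = (\<Sum>S\<in>Pow {..<N}. \<Sum>T\<in>{T \<in> ?A. S \<subseteq> T}. weight S m)"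
    by (rule sum.swap_restrict) auto
  also have "\<dots> = (\<Sum>S\<in>Pow {..<N}. real (N choose m) *
      (real (m choose card S) / real (N choose card S) * weight S m))"
  proof (rule sum.cong[OF refl])
    fix S assume S: "S \<in> Pow {..<N}"
    have kN: "card S \<le> N" using S card_mono[of "{..<N}" S] by auto
    have set_eq: "{T \<in> ?A. S \<subseteq> T} = {T. S \<subseteq> T \<and> T \<subseteq> {..<N} \<and> card T = m}" by auto
    \<comment> \<open>With \<open>k = card S\<close>, this is \<open>(N choose m) * (m choose k) =
      (N choose k) * ((N - k) choose (m - k))\<close>; both sides vanish if
      \<open>m < k\<close>.\<close>
    have "real (card {T \<in> ?A. S \<subseteq> T}) * real (N choose card S)
        = real (N choose m) * real (m choose card S)"
    proof (cases "card S \<le> m")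
      case True
      then show ?thesis
        unfolding set_eq using card_supersets[of S m] S choose_mult[OF True assms(2)]
        by (simp flip: of_nat_mult add: mult.commute)
    next
      case False
      have "{T. S \<subseteq> T \<and> T \<subseteq> {..<N} \<and> card T = m} = {}"
      proof safe
        fix T assume T: "S \<subseteq> T" "T \<subseteq> {..<N}" "m = card T"
        have "finite T" by (rule finite_subset[OF T(2)]) simp
        then show "T \<in> {}" using card_mono[OF _ T(1)] T(3) False by simp
      qed
      then show ?thesis unfolding set_eq using False by (simp add: binomial_eq_0)
    qed
    then have "real (card {T \<in> ?A. S \<subseteq> T})
        = real (N choose m) * (real (m choose card S) / real (N choose card S))"
      using kN by (simp add: field_simps)
    then show "(\<Sum>T\<in>{T \<in> ?A. S \<subseteq> T}. weight S m) = real (N choose m) *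
        (real (m choose card S) / real (N choose card S) * weight S m)"
      by (simp only: sum_constant mult.assoc)
  qed
  also have "\<dots> = real (N choose m) *
      (\<Sum>S\<in>Pow {..<N}. real (m choose card S) / real (N choose card S) * weight S m)"
    by (rule sum_distrib_left[symmetric])
  finally show ?thesis using le assms(2) by simp
qed

text \<open>The function \<open>t\<close> enters through a pointwise inequality only, which
  separates the probabilistic estimate from the study of the roots.\<close>

theorem risk_bound:
  assumes nondeg: "AE w in M. nondegenerate {..<N} w"
    and "0 \<le> \<beta>"
    and t: "\<And>k q. k \<le> N \<Longrightarrow> 0 \<le> q \<Longrightarrow> q < t k \<Longrightarrow>
      real (N choose k) * q ^ (N - k)
        \<le> \<beta> / real (N + 1) * (\<Sum>m=k..N. real (m choose k) * q ^ (m - k))"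
  shows "measure M {w \<in> space M. t (card (supp {..<N} w)) \<le> mass (sol {..<N} w)} \<ge> 1 - \<beta>"
proof -
  let ?bad = "{w \<in> space M. mass (sol {..<N} w) < t (card (supp {..<N} w))}"
  interpret M: prob_space M by (rule prob_space_M)
  \<comment> \<open>Unlike membership in \<open>?bad\<close>, the factor \<open>?h S\<close> depends
    only on the samples in \<open>S\<close>, so the remaining samples can be integrated out.\<close>
  let ?h = "\<lambda>S w. compression S w * of_bool (mass (sol S w) < t (card S))"
  let ?f = "\<lambda>S w. ?h S w * (\<Prod>i\<in>{..<N} - S. holds S i w)"
  have cardS: "card S \<le> N" if "S \<in> Pow {..<N}" for S
    using that card_mono[of "{..<N}" S] by auto
  have h_meas: "?h S \<in> borel_measurable M" if "S \<in> Pow {..<N}" for S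
  proof -
    have "S \<subseteq> {..<N}" using that by simp
    note [measurable] = compression_measurable[OF this] sol_measurable[OF this]
    show ?thesis by measurable
  qed
  have h_bounds: "0 \<le> ?h S w" "?h S w \<le> 1" for S w
    by (auto simp: compression_def)
  have f_nonneg: "0 \<le> ?f S w" for S w
    by (intro mult_nonneg_nonneg prod_nonneg h_bounds holds_bounds ballI)
  have f_int: "integrable M (?f S)" if "S \<in> Pow {..<N}" for S
  proof (rule integrable_bounded)
    show "?f S \<in> borel_measurable M"
      using that by (intro borel_measurable_times[OF h_meas] borel_measurable_prod holds_measurable) auto
    show "?f S w \<le> 1" for w
      by (intro mult_le_one h_bounds prod_nonneg prod_le_1 ballI conjI holds_bounds)
  qed (rule f_nonneg)
  have bad: "?bad \<in> sets M"
  proof -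
    have "?bad = (\<Union>S\<in>Pow {..<N}. {w \<in> space M. supp {..<N} w = S \<and> mass (sol {..<N} w) < t (card S)})"
      using supp_subset by auto
    moreover have "{w \<in> space M. supp {..<N} w = S \<and> mass (sol {..<N} w) < t (card S)} \<in> sets M" for S
      using supp_eq_measurable[of "{..<N}" S] sol_measurable[of "{..<N}"] by measurable
    ultimately show ?thesis by auto
  qed
  have w_int: "integrable M (\<lambda>w. compression S w * mass (sol S w) ^ j)" if "S \<in> Pow {..<N}" for S j
    using that compression_measurable[of S] sol_measurable[of S] compression_bounds mass_bounds
    by (intro integrable_bounded) (auto intro!: mult_le_one power_le_one)
  have "measure M ?bad = (\<integral>w. indicator ?bad w \<partial>M)" using bad by simp
  also have "\<dots> \<le> (\<integral>w. (\<Sum>S\<in>Pow {..<N}. ?f S w) \<partial>M)"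
  proof (rule integral_mono_AE)
    show "AE w in M. indicator ?bad w \<le> (\<Sum>S\<in>Pow {..<N}. ?f S w)"
      using nondeg AE_space
    proof eventually_elim
      case (elim w)
      let ?S = "supp {..<N} w"
      have w: "w \<in> {..<N} \<rightarrow> space P" by (rule space_M_Pi[OF elim(2)])
      have eq: "sol ?S w = sol {..<N} w" using elim(1) by (simp add: nondegenerate_def)
      \<comment> \<open>On the bad event every factor is 1 for the actual support: it is its own
        support, has the same solution, and that solution satisfies all samples.\<close>
      have "indicator ?bad w \<le> ?f ?S w"
        using compression_if_supp_eq[OF _ w elim(1)] sol_feasible[OF _ w, of "{..<N}"]
        by (auto simp: indicator_def compression_def prod_holds eq)
      also have "\<dots> \<le> (\<Sum>S\<in>Pow {..<N}. ?f S w)"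
        using supp_subset f_nonneg by (intro member_le_sum) auto
      finally show ?case .
    qed
  qed (use bad f_int in \<open>auto simp: M.emeasure_eq_measure\<close>)
  also have "\<dots> = (\<Sum>S\<in>Pow {..<N}. \<integral>w. ?f S w \<partial>M)"
    using f_int by (intro Bochner_Integration.integral_sum) auto
  also have "\<dots> \<le> (\<Sum>S\<in>Pow {..<N}. \<Sum>m=0..N. \<beta> / real (N + 1) *
      (real (m choose card S) / real (N choose card S) * weight S m))"
  proof (rule sum_mono)
    fix S assume S: "S \<in> Pow {..<N}"
    let ?k = "card S"
    let ?c = "\<lambda>m. \<beta> / real (N + 1) * (real (m choose ?k) / real (N choose ?k))"
    have fin: "finite S" using S finite_subset by auto
    have card_eq: "card ({..<N} - S) = N - ?k" using S fin by (simp add: card_Diff_subset)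
    have "(\<integral>w. ?f S w \<partial>M) = (\<integral>w. ?h S w * mass (sol S w) ^ (N - ?k) \<partial>M)"
      unfolding card_eq[symmetric] using S compression_update[of S] sol_update[of S]
      by (intro integral_fresh_samples h_meas h_bounds) auto
    also have "\<dots> \<le> (\<integral>w. (\<Sum>m=0..N. ?c m * (compression S w * mass (sol S w) ^ (m - ?k))) \<partial>M)"
    proof (rule integral_mono)
      show "integrable M (\<lambda>w. ?h S w * mass (sol S w) ^ (N - ?k))"
      proof (rule integrable_bounded)
        have "S \<subseteq> {..<N}" using S by simp
        note [measurable] = sol_measurable[OF this] h_meas[OF S]
        show "(\<lambda>w. ?h S w * mass (sol S w) ^ (N - ?k)) \<in> borel_measurable M" by measurable
      qed (intro mult_nonneg_nonneg mult_le_one h_bounds mass_bounds power_le_one zero_le_power)+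
      show "integrable M (\<lambda>w. \<Sum>m=0..N. ?c m * (compression S w * mass (sol S w) ^ (m - ?k)))"
        using w_int[OF S] by (intro Bochner_Integration.integrable_sum integrable_mult_right) auto
      fix w
      let ?q = "mass (sol S w)"
      have nonneg: "0 \<le> (\<Sum>m=0..N. ?c m * ?q ^ (m - ?k))"
        using assms(2) mass_bounds by (intro sum_nonneg mult_nonneg_nonneg) auto
      \<comment> \<open>This bound trades the power \<open>N - card S\<close> for a mixture of the
        powers \<open>m - card S\<close>, whose integrals are the weights.\<close>
      have "of_bool (?q < t ?k) * ?q ^ (N - ?k) \<le> (\<Sum>m=0..N. ?c m * ?q ^ (m - ?k))"
      proof (cases "?q < t ?k")
        case True
        have pos: "real (N choose ?k) > 0" using cardS[OF S] by simp
        \<comment> \<open>For \<open>m < card S\<close> the subtraction truncates, but the binomial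
          coefficient is 0.\<close>
        have "(\<Sum>m=?k..N. real (m choose ?k) * ?q ^ (m - ?k))
            = (\<Sum>m=0..N. real (m choose ?k) * ?q ^ (m - ?k))"
          by (rule sum.mono_neutral_left) auto
        then have "real (N choose ?k) * ?q ^ (N - ?k)
            \<le> \<beta> / real (N + 1) * (\<Sum>m=0..N. real (m choose ?k) * ?q ^ (m - ?k))"
          using t[OF cardS[OF S] mass_bounds(1) True] by simp
        then have "?q ^ (N - ?k)
            \<le> \<beta> / real (N + 1) * (\<Sum>m=0..N. real (m choose ?k) * ?q ^ (m - ?k)) / real (N choose ?k)"
          using pos by (simp only: pos_le_divide_eq mult.commute)
        also have "\<dots> = (\<Sum>m=0..N. ?c m * ?q ^ (m - ?k))"
          by (simp add: sum_distrib_left sum_divide_distrib mult.assoc)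
        finally show ?thesis using True by simp
      qed (use nonneg in simp)
      then have "compression S w * (of_bool (?q < t ?k) * ?q ^ (N - ?k))
          \<le> compression S w * (\<Sum>m=0..N. ?c m * ?q ^ (m - ?k))"
        by (rule mult_left_mono) (rule compression_bounds)
      then show "?h S w * ?q ^ (N - ?k) \<le> (\<Sum>m=0..N. ?c m * (compression S w * ?q ^ (m - ?k)))"
        by (simp only: sum_distrib_left mult_ac)
    qed
    also have "\<dots> = (\<Sum>m=0..N. ?c m * weight S m)"
      unfolding weight_def using w_int[OF S]
      by (subst Bochner_Integration.integral_sum) auto
    finally show "(\<integral>w. ?f S w \<partial>M) \<le> (\<Sum>m=0..N. \<beta> / real (N + 1) *
      (real (m choose ?k) / real (N choose ?k) * weight S m))" by (simp only: mult.assoc)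
  qed
  also have "\<dots> = (\<Sum>m=0..N. \<beta> / real (N + 1) *
      (\<Sum>S\<in>Pow {..<N}. real (m choose card S) / real (N choose card S) * weight S m))"
    by (subst sum.swap) (simp only: sum_distrib_left)
  also have "\<dots> \<le> (\<Sum>m=0..N. \<beta> / real (N + 1) * 1)"
    using weighted_sum_le_1[OF nondeg] assms(2) by (intro sum_mono mult_left_mono) auto
  also have "\<dots> = \<beta>" by simp
  finally have "measure M ?bad \<le> \<beta>" .
  moreover have "{w \<in> space M. t (card (supp {..<N} w)) \<le> mass (sol {..<N} w)} = space M - ?bad"
    by auto
  ultimately show ?thesis using M.prob_compl[OF bad] by simp
qed

end

section \<open>Games with sampled constraints\<close>

lemma profiles_strategies:
  "x \<in> profiles (strategies X I \<omega>) \<longleftrightarrow> (\<forall>i\<in>I. x \<in> profiles (\<lambda>j. X j (\<omega> i)))"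
  by (auto simp: profiles_def strategies_def)

lemma strategies_cong:
  "(\<And>i. i \<in> I \<Longrightarrow> \<omega> i = \<omega>' i) \<Longrightarrow> strategies X I \<omega> = strategies X I \<omega>'"
  by (simp add: strategies_def fun_eq_iff)

lemma x_NE_cong:
  "(\<And>i. i \<in> I \<Longrightarrow> \<omega> i = \<omega>' i) \<Longrightarrow> x_NE J X I \<omega> = x_NE J X I \<omega>'"
  using strategies_cong[of I \<omega> \<omega>' X] by (simp add: x_NE_def)

text \<open>The game hypotheses speak of the index sets \<open>{..<n}\<close> only; renumbering
  transfers them to games with constraints removed. The restriction makes the renumbered sample
  extensional, as product spaces demand.\<close>

lemma strategies_reindex:
  assumes "bij_betw e {..<n} I"
  shows "strategies X I \<omega> = strategies X {..<n} (\<lambda>i\<in>{..<n}. \<omega> (e i))"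
proof -
  have "I = e ` {..<n}" using assms by (simp add: bij_betw_def)
  then show ?thesis by (auto simp: strategies_def fun_eq_iff)
qed

lemma solves_vi_subset: "solves_vi F C x \<Longrightarrow> x \<in> D \<Longrightarrow> D \<subseteq> C \<Longrightarrow> solves_vi F D x"
  by (auto simp: solves_vi_def)

locale monotone_game =
  fixes P :: "'d measure"
    and X :: "'k::finite \<Rightarrow> 'd \<Rightarrow> (real^'m::finite) set"
    and J :: "'k \<Rightarrow> real^'m^'k \<Rightarrow> real"
  assumes prob_space_P: "prob_space P"
    and differentiable: "\<forall>j. continuously_differentiable (J j)"
    and convex_cost: "\<forall>j x. convex_on UNIV (\<lambda>y. J j (deviate x j y))"
    and constraints: "\<forall>N. \<forall>\<omega> \<in> {..<N} \<rightarrow> space P. \<forall>j.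
           strategies X {..<N} \<omega> j \<noteq> {} \<and>
           closed (strategies X {..<N} \<omega> j) \<and>
           convex (strategies X {..<N} \<omega> j)"
    and monotone: "\<forall>N. \<forall>\<omega> \<in> {..<N} \<rightarrow> space P.
         strongly_monotone_on (profiles (strategies X {..<N} \<omega>)) (game_operator J)"
begin

section \<open>Equilibria for arbitrary finite index sets\<close>

lemma reindex:
  fixes I :: "nat set"
  assumes "finite I" "\<omega> \<in> I \<rightarrow> space P"
  obtains n \<omega>' where "\<omega>' \<in> {..<n} \<rightarrow> space P" "strategies X I \<omega> = strategies X {..<n} \<omega>'"
proof -
  obtain e where e: "bij_betw e {..<card I} I"
    using ex_bij_betw_nat_finite[OF assms(1)] by (auto simp: atLeast0LessThan)
  have "(\<lambda>i\<in>{..<card I}. \<omega> (e i)) \<in> {..<card I} \<rightarrow> space P"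
    using assms(2) bij_betwE[OF e] by auto
  then show ?thesis using that strategies_reindex[OF e] by blast
qed

lemma strategies_props:
  fixes I :: "nat set"
  assumes "finite I" "\<omega> \<in> I \<rightarrow> space P"
  shows "strategies X I \<omega> j \<noteq> {}" "closed (strategies X I \<omega> j)" "convex (strategies X I \<omega> j)"
    "strongly_monotone_on (profiles (strategies X I \<omega>)) (game_operator J)"
proof -
  obtain n \<omega>' where eq: "\<omega>' \<in> {..<n} \<rightarrow> space P" "strategies X I \<omega> = strategies X {..<n} \<omega>'"
    using reindex[OF assms] .
  show "strategies X I \<omega> j \<noteq> {}" "closed (strategies X I \<omega> j)" "convex (strategies X I \<omega> j)"
    unfolding eq(2) using constraints[rule_format, OF eq(1), of j] by auto
  show "strongly_monotone_on (profiles (strategies X I \<omega>)) (game_operator J)"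
    unfolding eq(2) by (rule monotone[rule_format, OF eq(1)])
qed

lemma nash_iff_vi:
  fixes I :: "nat set"
  assumes "finite I" "\<omega> \<in> I \<rightarrow> space P"
  shows "nash_equilibrium J (strategies X I \<omega>) x
    \<longleftrightarrow> solves_vi (game_operator J) (profiles (strategies X I \<omega>)) x"
  by (rule nash_equilibrium_iff_solves_vi[OF differentiable convex_cost])
    (rule strategies_props(3)[OF assms])

lemma ex1_nash:
  fixes I :: "nat set"
  assumes "finite I" "\<omega> \<in> I \<rightarrow> space P"
  shows "\<exists>!x. nash_equilibrium J (strategies X I \<omega>) x"
proof -
  note props = strategies_props[OF assms]
  have "\<exists>x. solves_vi (game_operator J) (profiles (strategies X I \<omega>)) x"
    by (intro solves_vi_exists_strongly_monotone continuous_on_game_operator differentiable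
        closed_profiles convex_profiles nonempty_profiles props)
  then show ?thesis
    unfolding nash_iff_vi[OF assms] using solves_vi_unique[OF props(4)] by blast
qed

lemma x_NE_solves:
  fixes I :: "nat set"
  assumes "finite I" "\<omega> \<in> I \<rightarrow> space P"
  shows "solves_vi (game_operator J) (profiles (strategies X I \<omega>)) (x_NE J X I \<omega>)"
  unfolding nash_iff_vi[OF assms, symmetric] x_NE_def by (rule theI'[OF ex1_nash[OF assms]])

lemma x_NE_eqI:
  fixes I :: "nat set"
  assumes "finite I" "\<omega> \<in> I \<rightarrow> space P"
    and "solves_vi (game_operator J) (profiles (strategies X I \<omega>)) x"
  shows "x_NE J X I \<omega> = x"
  using solves_vi_unique[OF strategies_props(4)[OF assms(1,2)] x_NE_solves[OF assms(1,2)] assms(3)] .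

lemma x_NE_feasible:
  fixes I :: "nat set"
  assumes "finite I" "\<omega> \<in> I \<rightarrow> space P" "i \<in> I"
  shows "x_NE J X I \<omega> \<in> profiles (\<lambda>j. X j (\<omega> i))"
  using x_NE_solves[OF assms(1,2)] assms(3) by (auto simp: solves_vi_def profiles_strategies)

lemma x_NE_consistent:
  fixes S T :: "nat set"
  assumes "S \<subseteq> T" "finite T" "\<omega> \<in> T \<rightarrow> space P"
    and "\<And>i. i \<in> T \<Longrightarrow> x_NE J X S \<omega> \<in> profiles (\<lambda>j. X j (\<omega> i))"
  shows "x_NE J X T \<omega> = x_NE J X S \<omega>"
proof (rule x_NE_eqI[OF assms(2,3)])
  have "finite S" "\<omega> \<in> S \<rightarrow> space P" using assms finite_subset by auto
  then show "solves_vi (game_operator J) (profiles (strategies X T \<omega>)) (x_NE J X S \<omega>)"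
    using assms(1,4)
    by (intro solves_vi_subset[OF x_NE_solves]) (auto simp: profiles_strategies subset_iff)
qed

text \<open>Deleting constraints outside the Helly set \<open>A\<close> keeps \<open>?x\<close>
  feasible and the inequality valid, hence leaves the solution unchanged: only indices in
  \<open>A\<close> can be of support.\<close>

lemma card_support_constraints:
  assumes \<omega>: "\<omega> \<in> {..<N} \<rightarrow> space P"
  shows "card (support_constraints J X N \<omega>) \<le> CARD('k) * CARD('m)"
proof -
  let ?x = "x_NE J X {..<N} \<omega>" and ?F = "game_operator J"
  let ?K = "\<lambda>i. profiles (\<lambda>j. X j (\<omega> i))"
  have vi: "solves_vi ?F (profiles (strategies X {..<N} \<omega>)) ?x"
    using \<omega> by (intro x_NE_solves) auto
  have "\<exists>A\<subseteq>{..<N}. card A \<le> DIM(real^'m^'k) \<and> (\<forall>y\<in>(\<Inter>i\<in>A. ?K i). 0 \<le> ?F ?x \<bullet> (y - ?x))"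
  proof (rule helly_active_constraints)
    show "convex (?K i)" if "i \<in> {..<N}" for i
    proof (rule convex_profiles)
      \<comment> \<open>A single constraint set is the strategy set of the game with that sample
        alone.\<close>
      show "convex (X j (\<omega> i))" for j
        using strategies_props(3)[of "{i}" \<omega> j] that \<omega> by (auto simp: strategies_def)
    qed
    show "?x \<in> ?K i" if "i \<in> {..<N}" for i
      using that \<omega> by (intro x_NE_feasible) auto
    show "0 \<le> ?F ?x \<bullet> (y - ?x)" if "y \<in> (\<Inter>i\<in>{..<N}. ?K i)" for y
      using vi that by (auto simp: solves_vi_def profiles_strategies)
  qed simp
  then obtain A where A: "A \<subseteq> {..<N}" "card A \<le> CARD('k) * CARD('m)"
    "\<And>y. y \<in> (\<Inter>i\<in>A. ?K i) \<Longrightarrow> 0 \<le> ?F ?x \<bullet> (y - ?x)"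
    by auto
  have eq: "x_NE J X I \<omega> = ?x" if I: "A \<subseteq> I" "I \<subseteq> {..<N}" for I
  proof (rule x_NE_eqI)
    show "finite I" using I(2) finite_subset by blast
    show "\<omega> \<in> I \<rightarrow> space P" using I(2) \<omega> by auto
    have "?x \<in> profiles (strategies X I \<omega>)"
      using vi I(2) by (auto simp: solves_vi_def profiles_strategies)
    then show "solves_vi ?F (profiles (strategies X I \<omega>)) ?x"
      using A(3) subsetD[OF I(1)] by (simp add: solves_vi_def profiles_strategies)
  qed
  have "support_constraints J X N \<omega> \<subseteq> A"
  proof
    fix i assume i: "i \<in> support_constraints J X N \<omega>"
    show "i \<in> A"
    proof (rule ccontr)
      assume "i \<notin> A"
      then have "x_NE J X ({..<N} - {i}) \<omega> = ?x" using A(1) by (intro eq) auto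
      then show False using i by (simp add: support_constraints_def)
    qed
  qed
  then have "card (support_constraints J X N \<omega>) \<le> card A"
    using A(1) by (intro card_mono) (auto intro: finite_subset)
  then show ?thesis using A(2) by simp
qed

text \<open>\<open>measurable_game\<close> covers initial segments of indices; other index sets are
  reached by composing with a measurable renumbering of coordinates.\<close>

lemma x_NE_measurable:
  assumes meas: "measurable_game P J X" and S: "S \<subseteq> {..<N}"
  shows "x_NE J X S \<in> borel_measurable (PiM {..<N} (\<lambda>_. P))"
proof -
  have "finite S" using S finite_subset by blast
  then obtain e where e: "bij_betw e {..<card S} S"
    using ex_bij_betw_nat_finite by (auto simp: atLeast0LessThan)
  have "(\<lambda>\<omega>. \<lambda>i\<in>{..<card S}. \<omega> (e i)) \<in> measurable (PiM {..<N} (\<lambda>_. P)) (PiM {..<card S} (\<lambda>_. P))"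
    using bij_betwE[OF e] S by (intro measurable_restrict measurable_component_singleton) auto
  moreover have "x_NE J X {..<card S} \<in> borel_measurable (PiM {..<card S} (\<lambda>_. P))"
    using meas by (simp add: measurable_game_def sample_measure_def)
  ultimately have "(\<lambda>\<omega>. x_NE J X {..<card S} (\<lambda>i\<in>{..<card S}. \<omega> (e i)))
      \<in> borel_measurable (PiM {..<N} (\<lambda>_. P))"
    by (rule measurable_compose)
  moreover have "x_NE J X S = (\<lambda>\<omega>. x_NE J X {..<card S} (\<lambda>i\<in>{..<card S}. \<omega> (e i)))"
    by (simp add: x_NE_def fun_eq_iff strategies_reindex[OF e])
  ultimately show ?thesis by simp
qed

definition feasible :: "((real^'m^'k) \<times> 'd) set" where
  "feasible = {(x, \<delta>). \<delta> \<in> space P \<and> x \<in> profiles (\<lambda>j. X j \<delta>)}"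

lemma scenario:
  assumes "measurable_game P J X"
  shows "scenario P N (x_NE J X) feasible"
proof -
  interpret prob_space P by (rule prob_space_P)
  have fin: "finite S" if "S \<subseteq> {..<N}" for S using that finite_subset by blast
  have sub: "\<omega> \<in> S \<rightarrow> space P" if "S \<subseteq> {..<N}" "\<omega> \<in> {..<N} \<rightarrow> space P" for S \<omega>
    using that by auto
  show ?thesis
  proof (unfold_locales)
    show "feasible \<in> sets (borel \<Otimes>\<^sub>M P)"
      using assms by (simp add: measurable_game_def feasible_def)
    show "x_NE J X S \<in> borel_measurable (PiM {..<N} (\<lambda>_. P))" if "S \<subseteq> {..<N}" for S
      by (rule x_NE_measurable[OF assms that])
    show "x_NE J X S \<omega> = x_NE J X S \<omega>'" if "\<And>i. i \<in> S \<Longrightarrow> \<omega> i = \<omega>' i" for S \<omega> \<omega>'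
      using that by (rule x_NE_cong)
    show "(x_NE J X S \<omega>, \<omega> i) \<in> feasible"
      if "S \<subseteq> {..<N}" "\<omega> \<in> {..<N} \<rightarrow> space P" "i \<in> S" for S \<omega> i
      using x_NE_feasible[OF fin sub, OF that(1) that(1,2,3)] that by (auto simp: feasible_def)
    show "x_NE J X T \<omega> = x_NE J X S \<omega>"
      if "S \<subseteq> T" "T \<subseteq> {..<N}" "\<omega> \<in> {..<N} \<rightarrow> space P"
        "\<And>i. i \<in> T \<Longrightarrow> (x_NE J X S \<omega>, \<omega> i) \<in> feasible" for S T \<omega>
      using that(4) by (intro x_NE_consistent[OF that(1) fin sub] that(2,3)) (auto simp: feasible_def)
  qed
qed

lemma risk_eq:
  assumes "measurable_game P J X"
  shows "risk P X x = 1 - measure P (Pair x -` feasible)"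
proof -
  interpret prob_space P by (rule prob_space_P)
  have "feasible \<in> sets (borel \<Otimes>\<^sub>M P)"
    using assms by (simp add: measurable_game_def feasible_def)
  then have "Pair x -` feasible \<in> sets P" by (rule sets_Pair1)
  moreover have "{\<delta> \<in> space P. x \<notin> profiles (\<lambda>j. X j \<delta>)} = space P - Pair x -` feasible"
    by (auto simp: feasible_def)
  ultimately show ?thesis by (simp add: risk_def prob_compl)
qed

theorem risk_bounds:
  assumes meas: "measurable_game P J X" and \<beta>: "0 < \<beta>" "\<beta> < 1"
    and nondeg: "AE \<omega> in sample_measure P N.
      x_NE J X {..<N} \<omega> = x_NE J X (support_constraints J X N \<omega>) \<omega>"
  shows "\<P>(\<omega> in sample_measure P N. risk P X (x_NE J X {..<N} \<omega>)
      \<le> eps N \<beta> (card (support_constraints J X N \<omega>))) \<ge> 1 - \<beta>"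
    and "\<P>(\<omega> in sample_measure P N. risk P X (x_NE J X {..<N} \<omega>)
      \<le> eps N \<beta> (CARD('k) * CARD('m))) \<ge> 1 - \<beta>"
proof -
  interpret scenario P N "x_NE J X" feasible by (rule scenario[OF meas])
  interpret M: prob_space M by (rule prob_space_M)
  have supp: "supp {..<N} \<omega> = support_constraints J X N \<omega>" for \<omega>
    by (simp add: supp_def support_constraints_def)
  have le_iff: "risk P X x \<le> eps N \<beta> k \<longleftrightarrow> t_root N \<beta> k \<le> mass x" for x k
    by (simp add: risk_eq[OF meas] eps_def mass_def)
  have "AE \<omega> in M. nondegenerate {..<N} \<omega>"
    using nondeg unfolding sample_measure_def
    by eventually_elim (simp add: nondegenerate_def supp)
  then have post: "measure M {\<omega> \<in> space M. t_root N \<beta> (card (supp {..<N} \<omega>)) \<le> mass (x_NE J X {..<N} \<omega>)} \<ge> 1 - \<beta>"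
    using below_t_root[OF \<beta>] \<beta> by (intro risk_bound) auto
  then show "\<P>(\<omega> in sample_measure P N. risk P X (x_NE J X {..<N} \<omega>)
      \<le> eps N \<beta> (card (support_constraints J X N \<omega>))) \<ge> 1 - \<beta>"
    by (simp add: le_iff supp sample_measure_def)
  note [measurable] = sol_measurable[of "{..<N}", OF order_refl]
  have "{\<omega> \<in> space M. t_root N \<beta> (CARD('k) * CARD('m)) \<le> mass (x_NE J X {..<N} \<omega>)} \<in> sets M"
    by measurable
  \<comment> \<open>At most \<open>CARD('k) * CARD('m)\<close> constraints are of support and
    \<open>t_root\<close> is antitone, so the a-posteriori event lies in the a-priori one.\<close>
  moreover have "t_root N \<beta> (CARD('k) * CARD('m)) \<le> t_root N \<beta> (card (supp {..<N} \<omega>))"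
    if "\<omega> \<in> space M" for \<omega>
    unfolding supp by (intro t_root_antitone \<beta> card_support_constraints space_M_Pi that)
  then have "{\<omega> \<in> space M. t_root N \<beta> (card (supp {..<N} \<omega>)) \<le> mass (x_NE J X {..<N} \<omega>)}
      \<subseteq> {\<omega> \<in> space M. t_root N \<beta> (CARD('k) * CARD('m)) \<le> mass (x_NE J X {..<N} \<omega>)}"
    using order_trans by blast
  ultimately have "measure M {\<omega> \<in> space M. t_root N \<beta> (CARD('k) * CARD('m)) \<le> mass (x_NE J X {..<N} \<omega>)} \<ge> 1 - \<beta>"
    using post M.finite_measure_mono order_trans by blast
  then show "\<P>(\<omega> in sample_measure P N. risk P X (x_NE J X {..<N} \<omega>)
      \<le> eps N \<beta> (CARD('k) * CARD('m))) \<ge> 1 - \<beta>"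
    by (simp add: le_iff sample_measure_def)
qed

end

theorem corollary1:
  fixes P :: "'d measure"
    and X :: "'k::finite \<Rightarrow> 'd \<Rightarrow> (real^'m::finite) set"
    and J :: "'k \<Rightarrow> real^'m^'k \<Rightarrow> real"
  assumes "prob_space P"
    and "\<forall>j. continuously_differentiable (J j)"
    and "\<forall>j x. convex_on UNIV (\<lambda>y. J j (deviate x j y))"
    and "\<forall>N. \<forall>\<omega> \<in> {..<N} \<rightarrow> space P. \<forall>j.
           strategies X {..<N} \<omega> j \<noteq> {} \<and>
           closed (strategies X {..<N} \<omega> j) \<and>
           convex (strategies X {..<N} \<omega> j)"
  shows
    "(\<forall>N. \<forall>\<omega> \<in> {..<N} \<rightarrow> space P.
        (\<forall>j. bounded (strategies X {..<N} \<omega> j)) \<longrightarrow>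
        (\<exists>x. nash_equilibrium J (strategies X {..<N} \<omega>) x))
     \<and>
     ((\<forall>N. \<forall>\<omega> \<in> {..<N} \<rightarrow> space P.
         strongly_monotone_on (profiles (strategies X {..<N} \<omega>)) (game_operator J)) \<longrightarrow>
      (\<forall>N. \<forall>\<omega> \<in> {..<N} \<rightarrow> space P.
         \<exists>!x. nash_equilibrium J (strategies X {..<N} \<omega>) x)
      \<and>
      (measurable_game P J X \<longrightarrow>
       (\<forall>N \<beta>. 0 < \<beta> \<and> \<beta> < 1 \<and>
          (AE \<omega> in sample_measure P N.
             x_NE J X {..<N} \<omega> = x_NE J X (support_constraints J X N \<omega>) \<omega>) \<longrightarrow>
          \<P>(\<omega> in sample_measure P N.
             risk P X (x_NE J X {..<N} \<omega>)
               \<le> eps N \<beta> (card (support_constraints J X N \<omega>))) \<ge> 1 - \<beta> \<and>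
          \<P>(\<omega> in sample_measure P N.
             risk P X (x_NE J X {..<N} \<omega>) \<le> eps N \<beta> (CARD('k) * CARD('m))) \<ge> 1 - \<beta>)))"
proof (intro conjI impI)
  show "\<forall>N. \<forall>\<omega> \<in> {..<N} \<rightarrow> space P. (\<forall>j. bounded (strategies X {..<N} \<omega> j)) \<longrightarrow>
      (\<exists>x. nash_equilibrium J (strategies X {..<N} \<omega>) x)"
  proof (intro allI ballI impI)
    fix N \<omega> assume \<omega>: "\<omega> \<in> {..<N} \<rightarrow> space P" and bd: "\<forall>j. bounded (strategies X {..<N} \<omega> j)"
    let ?C = "strategies X {..<N} \<omega>"
    have C: "?C j \<noteq> {}" "closed (?C j)" "convex (?C j)" for j using assms(4) \<omega> by auto
    \<comment> \<open>Boundedness gives compactness. On unbounded sets an equilibrium can fail to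
      exist, as for one agent on the real line with cost \<open>exp\<close>.\<close>
    have "compact (profiles ?C)"
      using bounded_profiles[of ?C] closed_profiles[of ?C] bd C(2) by (simp add: compact_eq_bounded_closed)
    then have "\<exists>x. solves_vi (game_operator J) (profiles ?C) x"
      by (intro solves_vi_exists_compact continuous_on_game_operator assms(2) convex_profiles
          nonempty_profiles C)
    then show "\<exists>x. nash_equilibrium J ?C x"
      using nash_equilibrium_iff_solves_vi[OF assms(2,3), of ?C] C(3) by blast
  qed
next
  assume "\<forall>N. \<forall>\<omega> \<in> {..<N} \<rightarrow> space P.
      strongly_monotone_on (profiles (strategies X {..<N} \<omega>)) (game_operator J)"
  then interpret monotone_game P X J
    using assms by (intro monotone_game.intro)
  show "\<forall>N. \<forall>\<omega> \<in> {..<N} \<rightarrow> space P. \<exists>!x. nash_equilibrium J (strategies X {..<N} \<omega>) x"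
    using ex1_nash by blast
  assume "measurable_game P J X"
  then show "\<forall>N \<beta>. 0 < \<beta> \<and> \<beta> < 1 \<and>
          (AE \<omega> in sample_measure P N.
             x_NE J X {..<N} \<omega> = x_NE J X (support_constraints J X N \<omega>) \<omega>) \<longrightarrow>
          \<P>(\<omega> in sample_measure P N.
             risk P X (x_NE J X {..<N} \<omega>)
               \<le> eps N \<beta> (card (support_constraints J X N \<omega>))) \<ge> 1 - \<beta> \<and>
          \<P>(\<omega> in sample_measure P N.
             risk P X (x_NE J X {..<N} \<omega>) \<le> eps N \<beta> (CARD('k) * CARD('m))) \<ge> 1 - \<beta>"
    using risk_bounds by blast
qed

end
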